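(* Let $\psi:\mathbb{N}\to\mathbb{R}^+$ be a function satisfying $\psi(n)/n\to\infty$ as $n\to\infty$. Define $b,B\in[1,\infty]$ by \[ \log b:=\liminf_{n\to\infty}\frac{\log\psi(n)}{n}\quad\text{and}\quad \log B:=\limsup_{n\to\infty}\frac{\log\psi(n)}{n}. \] Let \[ \overline{E}(\psi):=\left\{x\in(0,1):\limsup_{n\to\infty}\frac{\log a_1(x)+\cdots+\log a_n(x)}{\psi(n)}=1\right\} \] and \[ \underline{E}(\psi):=\left\{x\in(0,1):\liminf_{n\to\infty}\frac{\log a_1(x)+\cdots+\log a_n(x)}{\psi(n)}=1\right\}. \] Then \[ \dim_{\rm H}\overline{E}(\psi)=\frac{1}{b+1}\quad\text{and}\quad\dim_{\rm H}\underline{E}(\psi)=\frac{1}{B+1}. \]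
   Context: $\mathbb{N}=\{1,2,3,\dots\}$ and $\mathbb{R}^+$ is the set of positive real numbers. For $x\in(0,1)$, $a_n(x)$ denotes the $n$-th partial quotient of the regular continued fraction expansion $x=[a_1(x),a_2(x),a_3(x),\dots]$: with the Gauss map $G:[0,1)\to[0,1)$, $G(0):=0$, $G(x):=1/x-\lfloor 1/x\rfloor$ for $x\in(0,1)$, one sets $a_1(x):=\lfloor 1/x\rfloor$ and $a_n(x):=a_1(G^{n-1}(x))$ for $n\ge 2$. Sets of $x\in(0,1)$ defined through the whole sequence $(a_n(x))_{n\ge1}$ are understood to consist of irrational $x$ (those with an infinite expansion). $\dim_{\rm H}$ denotes Hausdorff dimension. Conventions: $\log b=\infty$ means $b=\infty$ (likewise for $B$), and $1/(\infty+1)=0$. *)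

theory Defs
  imports "HOL-Analysis.Analysis"
begin

definition gauss_map :: "real \<Rightarrow> real" where
  "gauss_map x = (if x = 0 then 0 else 1 / x - of_int \<lfloor>1 / x\<rfloor>)"

(* Indexed from n = 1; the value at n = 0 is a junk value. *)
definition partial_quotient :: "nat \<Rightarrow> real \<Rightarrow> int" where
  "partial_quotient n x = \<lfloor>1 / (gauss_map ^^ (n - 1)) x\<rfloor>"

(* diam(U)^s with the usual conventions 0^0 = 1 for nonempty U and value 0 for the empty set;
   powr alone would give 0 powr 0 = 0. *)
definition diam_pow :: "real \<Rightarrow> 'a::metric_space set \<Rightarrow> ennreal" where
  "diam_pow s U = (if U = {} then 0 else if s = 0 then 1 else ennreal (diameter U powr s))"

(* Boundedness is required because diameter is a real number, underspecified on unbounded sets. *)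
definition fine_covers :: "real \<Rightarrow> 'a::metric_space set \<Rightarrow> (nat \<Rightarrow> 'a set) set" where
  "fine_covers \<delta> A = {U. A \<subseteq> (\<Union>i. U i) \<and> (\<forall>i. bounded (U i) \<and> diameter (U i) \<le> \<delta>)}"

definition hausdorff_measure :: "real \<Rightarrow> 'a::metric_space set \<Rightarrow> ennreal" where
  "hausdorff_measure s A = (SUP \<delta>\<in>{0<..}. INF U\<in>fine_covers \<delta> A. \<Sum>i. diam_pow s (U i))"

definition hausdorff_dim :: "'a::metric_space set \<Rightarrow> ereal" where
  "hausdorff_dim A = (INF s\<in>{s. 0 \<le> s \<and> hausdorff_measure s A = 0}. ereal s)"

(* Natural logarithm on the extended reals: ln 0 = -\<infinity> and ln \<infinity> = \<infinity>. *)
definition ln_ereal :: "ereal \<Rightarrow> ereal" where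
  "ln_ereal x = (if x \<le> 0 then - \<infinity> else if x = \<infinity> then \<infinity> else ereal (ln (real_of_ereal x)))"

lemma ex1_ln_ereal:
  assumes "0 \<le> l"
  shows "\<exists>!b. 1 \<le> b \<and> ln_ereal b = l"
proof (cases l)
  case (real r)
  then have "ln_ereal (ereal (exp r)) = l" "1 \<le> ereal (exp r)"
    using assms by (auto simp: ln_ereal_def not_le)
  moreover have "b = ereal (exp r)" if "1 \<le> b" "ln_ereal b = l" for b
    using that real by (cases b) (auto simp: ln_ereal_def split: if_splits)
  ultimately show ?thesis by blast
next
  case PInf
  have "b = \<infinity>" if "1 \<le> b" "ln_ereal b = l" for b
    using that PInf by (cases b) (auto simp: ln_ereal_def split: if_splits)
  then show ?thesis using PInf by (intro ex1I[of _ \<infinity>]) (auto simp: ln_ereal_def)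
qed (use assms in auto)

definition log_quotient_sum :: "nat \<Rightarrow> real \<Rightarrow> real" where
  "log_quotient_sum n x = (\<Sum>k=1..n. ln (of_int (partial_quotient k x)))"

definition E_upper :: "(nat \<Rightarrow> real) \<Rightarrow> real set" where
  "E_upper \<psi> = {x. 0 < x \<and> x < 1 \<and> x \<notin> \<rat> \<and>
     limsup (\<lambda>n. ereal (log_quotient_sum n x / \<psi> n)) = 1}"

definition E_lower :: "(nat \<Rightarrow> real) \<Rightarrow> real set" where
  "E_lower \<psi> = {x. 0 < x \<and> x < 1 \<and> x \<notin> \<rat> \<and>
     liminf (\<lambda>n. ereal (log_quotient_sum n x / \<psi> n)) = 1}"

end

(* Write S_n = log a_1 + ... + log a_n.

   Upper bounds. The points with prescribed a_1, ..., a_n and a_{n+1} >= L form a set of diameter at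
   most exp (-2 S_n) / L. If S_n >= c^n infinitely often and c' < c, then
   S_{n+1} >= c' max (S_n, c'^n) infinitely often, and covering by the corresponding sets gives
   dimension at most 1/(c+1). For c = 1 only S_n >= M n infinitely often for all M is used, with
   cylinders as covering sets.

   Lower bounds. Let theta be nondecreasing with theta(n)/n -> infinity and
   theta(n+1) <= beta theta(n). For t in [0,1) let c_k be its digits in the mixed radix system with
   bases m_k ~ exp (theta(k+1) - theta(k)), and let x(t) have partial quotients m_k + c_k. Then
   S_n(x(t)) ~ theta(n), and t is a Hoelder function of x(t) with any exponent s < 1/(beta+1), so the
   range of x has positive s-dimensional measure. For beta > b the minorant
   min_k psi(k) beta^max(n-k,0), and for beta > B the majorant max_k psi(k) / beta^max(k-n,0), are
   such functions theta and coincide with psi infinitely often. Hence S_n ~ theta(n) forces the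
   upper, respectively lower, limit of S_n / psi(n) to be 1. *)

theory Submission
  imports Defs "HOL-Real_Asymp.Real_Asymp"
begin

section \<open>Hausdorff measure\<close>

text \<open>Both exponents come from one geometric fact. Points with common a_1, ..., a_n and
  a_{n+1} of size exp (S_{n+1} - S_n) lie in a set of diameter at most about exp (- (S_n +
  S_{n+1})), because the sibling cylinders with large a_{n+1} crowd together where the n-th Gauss
  image is near 0. For each \<alpha> > 1 at most zeta(\<alpha>)^n exp (\<alpha> S) prefixes of
  length n have S_n \<le> S. Hence the critical exponent is S_n / (S_n + S_{n+1}), which is 1/(c+1)
  if S_{n+1} = c S_n. In the lower bound, n digits locate t up to exp (- theta(n)), while x is
  confined to length about exp (- theta(n) - theta(n+1)), so the same quotient returns. All these
  estimates lose factors C^n. They are harmless because the exponents outgrow n: through psi(n)/n ->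
  infinity, or through the term c'^n in the maximum. The envelopes are forced by psi itself: it may
  oscillate or jump arbitrarily, whereas S_n is nondecreasing and the Hoelder estimate needs bounded
  growth factors.\<close>

lemma hausdorff_measure_mono:
  assumes "A \<subseteq> B"
  shows "hausdorff_measure s A \<le> hausdorff_measure s B"
  unfolding hausdorff_measure_def
proof (rule SUP_mono)
  fix \<delta> :: real assume "\<delta> \<in> {0<..}"
  moreover have "fine_covers \<delta> B \<subseteq> fine_covers \<delta> A"
    using assms by (auto simp: fine_covers_def)
  ultimately show "\<exists>\<delta>'\<in>{0<..}. (INF U\<in>fine_covers \<delta> A. \<Sum>i. diam_pow s (U i))
      \<le> (INF U\<in>fine_covers \<delta>' B. \<Sum>i. diam_pow s (U i))"
    by (intro bexI[of _ \<delta>] INF_superset_mono) auto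
qed

text \<open>A total of at most \<delta>^s bounds every single term, so each covering set
  automatically has diameter at most \<delta>. Covers can therefore be built without watching the
  mesh.\<close>

lemma hausdorff_measure_eq_0I:
  fixes A :: "'a::metric_space set"
  assumes "s > 0"
    and cover: "\<And>\<epsilon>. \<epsilon> > 0 \<Longrightarrow> \<exists>U. A \<subseteq> (\<Union>i. U i) \<and> (\<forall>i. bounded (U i)) \<and>
      (\<Sum>i. diam_pow s (U i)) \<le> ennreal \<epsilon>"
  shows "hausdorff_measure s A = 0"
proof -
  have "(INF U\<in>fine_covers \<delta> A. \<Sum>i. diam_pow s (U i)) = 0" if "\<delta> > 0" for \<delta>
  proof -
    have "(INF U\<in>fine_covers \<delta> A. \<Sum>i. diam_pow s (U i)) \<le> 0 + ennreal \<epsilon>" if "\<epsilon> > 0" for \<epsilon>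
    proof -
      define \<eta> where "\<eta> = min \<epsilon> (\<delta> powr s)"
      have "\<eta> > 0" using \<open>\<delta> > 0\<close> \<open>\<epsilon> > 0\<close> by (simp add: \<eta>_def)
      then obtain U where U: "A \<subseteq> (\<Union>i. U i)" "\<And>i. bounded (U i)"
        "(\<Sum>i. diam_pow s (U i)) \<le> ennreal \<eta>"
        using cover by metis
      have "diameter (U i) \<le> \<delta>" for i
      proof (cases "U i = {}")
        case False
        have "diam_pow s (U i) \<le> (\<Sum>i. diam_pow s (U i))"
          using sum_le_suminf[of "\<lambda>i. diam_pow s (U i)" "{i}"] by simp
        also have "\<dots> \<le> ennreal (\<delta> powr s)"
          using U(3) by (rule order_trans) (simp add: \<eta>_def ennreal_leI)
        finally have "diameter (U i) powr s \<le> \<delta> powr s"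
          using False \<open>s > 0\<close> by (simp add: diam_pow_def)
        then show ?thesis
          using powr_less_mono2[of s \<delta> "diameter (U i)"] \<open>s > 0\<close> \<open>\<delta> > 0\<close> by (meson less_imp_le not_le)
      qed (use \<open>\<delta> > 0\<close> in auto)
      then have "U \<in> fine_covers \<delta> A"
        using U by (auto simp: fine_covers_def)
      then have "(INF U\<in>fine_covers \<delta> A. \<Sum>i. diam_pow s (U i)) \<le> ennreal \<eta>"
        by (rule INF_lower2) (rule U(3))
      then show ?thesis
        by (rule order_trans) (simp add: \<eta>_def ennreal_leI)
    qed
    then have "(INF U\<in>fine_covers \<delta> A. \<Sum>i. diam_pow s (U i)) \<le> 0"
      by (rule ennreal_le_epsilon)
    then show ?thesis by simp
  qed
  then show ?thesis
    by (simp add: hausdorff_measure_def)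
qed

text \<open>Mass distribution argument in Hoelder form: a cover of \<open>A\<close> pulls back along
  \<open>g\<close> to a cover of [0,1) whose i-th member has length at most \<open>C\<close> times
  diam (U i)^s, and the lengths add up to at least 1. Looking at mesh 1 suffices, since the measure
  is a supremum over meshes.\<close>

lemma hausdorff_measure_neq_0I:
  fixes A :: "'a::metric_space set" and g :: "real \<Rightarrow> 'a"
  assumes "C > 0" "s \<ge> 0" and g: "\<And>t. t \<in> {0..<1} \<Longrightarrow> g t \<in> A"
    and hoelder: "\<And>t u. t \<in> {0..<1} \<Longrightarrow> u \<in> {0..<1} \<Longrightarrow> t \<noteq> u \<Longrightarrow> \<bar>t - u\<bar> \<le> C * dist (g t) (g u) powr s"
  shows "hausdorff_measure s A \<noteq> 0"
proof -
  have sum_ge: "ennreal (1 / C) \<le> (\<Sum>i. diam_pow s (U i))" if "U \<in> fine_covers 1 A" for U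
  proof -
    have cov: "A \<subseteq> (\<Union>i. U i)" and bdd: "\<And>i. bounded (U i)"
      using that by (auto simp: fine_covers_def)
    define T where "T i = {t \<in> {0..<1}. g t \<in> U i}" for i
    \<comment> \<open>The pulled-back set \<open>T i\<close> may fail to be measurable, so its
      interval hull is measured instead.\<close>
    define J where "J i = (if T i = {} then {} else {Inf (T i)..Sup (T i)})" for i
    have bT: "bdd_above (T i)" "bdd_below (T i)" for i
      by (auto simp: T_def intro!: bdd_aboveI[of _ 1] bdd_belowI[of _ 0])
    have "T i \<subseteq> J i" for i
      using bT[of i] by (auto simp: J_def intro: cInf_lower cSup_upper)
    moreover have "{0..<1} \<subseteq> (\<Union>i. T i)"
    proof
      fix t :: real assume t: "t \<in> {0..<1}"
      then have "g t \<in> (\<Union>i. U i)" using g cov by (meson subsetD)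
      then obtain i where "g t \<in> U i" by blast
      with t show "t \<in> (\<Union>i. T i)" by (auto simp: T_def)
    qed
    ultimately have "{0..<1} \<subseteq> (\<Union>i. J i)"
      by (meson SUP_mono' order_trans)
    then have "emeasure lborel {0..<1::real} \<le> emeasure lborel (\<Union>i. J i)"
      by (rule emeasure_mono) (auto simp: J_def)
    also have "\<dots> \<le> (\<Sum>i. emeasure lborel (J i))"
      by (rule emeasure_subadditive_countably) (auto simp: J_def)
    also have "\<dots> \<le> (\<Sum>i. ennreal C * diam_pow s (U i))"
    proof (intro suminf_le summableI)
      fix i
      show "emeasure lborel (J i) \<le> ennreal C * diam_pow s (U i)"
      proof (cases "T i = {}")
        case False
        then have "U i \<noteq> {}" by (auto simp: T_def)
        define l where "l = C * (if s = 0 then 1 else diameter (U i) powr s)"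
        have "l \<ge> 0" using \<open>C > 0\<close> by (auto simp: l_def)
        have l: "t - u \<le> l" if "t \<in> T i" "u \<in> T i" for t u
        proof (cases "t = u")
          case True
          then show ?thesis using \<open>l \<ge> 0\<close> by simp
        next
          case False
          have "dist (g t) (g u) \<le> diameter (U i)"
            using that bdd by (intro diameter_bounded_bound) (auto simp: T_def)
          then have "dist (g t) (g u) powr s \<le> (if s = 0 then 1 else diameter (U i) powr s)"
            using \<open>s \<ge> 0\<close> by (auto intro: powr_mono2)
          then have "C * dist (g t) (g u) powr s \<le> l"
            using \<open>C > 0\<close> unfolding l_def by (intro mult_left_mono) auto
          moreover have "\<bar>t - u\<bar> \<le> C * dist (g t) (g u) powr s"
            using that False by (intro hoelder) (auto simp: T_def)
          ultimately show ?thesis by linarith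
        qed
        have "Sup (T i) \<le> l + Inf (T i)"
        proof (rule cSup_least[OF False])
          fix t assume t: "t \<in> T i"
          have "t - l \<le> Inf (T i)"
          proof (rule cInf_greatest[OF False])
            fix u assume "u \<in> T i"
            then show "t - l \<le> u" using l[OF t, of u] by simp
          qed
          then show "t \<le> l + Inf (T i)" by simp
        qed
        moreover have "Inf (T i) \<le> Sup (T i)"
          using False bT by (simp add: cInf_le_cSup)
        ultimately have "emeasure lborel (J i) \<le> ennreal l"
          using False by (auto simp: J_def intro!: ennreal_leI)
        also have "ennreal l = ennreal C * diam_pow s (U i)"
          using \<open>U i \<noteq> {}\<close> \<open>C > 0\<close> by (auto simp: l_def diam_pow_def ennreal_mult)
        finally show ?thesis .
      qed (simp add: J_def)
    qed
    also have "\<dots> = ennreal C * (\<Sum>i. diam_pow s (U i))"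
      by simp
    finally have "1 \<le> ennreal C * (\<Sum>i. diam_pow s (U i))" by simp
    then have "ennreal (1 / C) * 1 \<le> ennreal (1 / C) * (ennreal C * (\<Sum>i. diam_pow s (U i)))"
      by (intro mult_left_mono) auto
    also have "\<dots> = (\<Sum>i. diam_pow s (U i))"
      using \<open>C > 0\<close> by (simp add: mult.assoc[symmetric] ennreal_mult[symmetric])
    finally show ?thesis by simp
  qed
  have "ennreal (1 / C) \<le> (INF U\<in>fine_covers 1 A. \<Sum>i. diam_pow s (U i))"
    by (intro INF_greatest sum_ge)
  also have "\<dots> \<le> hausdorff_measure s A"
    unfolding hausdorff_measure_def by (rule SUP_upper) simp
  finally show ?thesis
    using \<open>C > 0\<close> by (auto simp: ennreal_eq_0_iff)
qed


section \<open>Partial quotients and cylinders\<close>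

text \<open>Irrationality keeps the whole orbit under \<open>gauss_map\<close> away from 0, so every
  partial quotient is a genuine one and at least 1.\<close>

definition unit_irrationals :: "real set" where
  "unit_irrationals = {x. 0 < x \<and> x < 1 \<and> x \<notin> \<rat>}"

lemma gauss_map_unit_irrationals:
  assumes "x \<in> unit_irrationals"
  shows "gauss_map x \<in> unit_irrationals"
proof -
  have x: "0 < x" "x < 1" "x \<notin> \<rat>" using assms by (auto simp: unit_irrationals_def)
  have eq: "gauss_map x = frac (1 / x)" using x by (simp add: gauss_map_def frac_def)
  have irr: "gauss_map x \<notin> \<rat>"
  proof
    assume "gauss_map x \<in> \<rat>"
    then have "gauss_map x + of_int \<lfloor>1 / x\<rfloor> \<in> \<rat>" by simp
    then have "1 / x \<in> \<rat>" using x by (simp add: gauss_map_def)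
    then have "1 / (1 / x) \<in> \<rat>" by (rule Rats_divide[OF Rats_1])
    then show False using x(3) by (metis div_by_1 divide_divide_eq_right mult_1)
  qed
  moreover from irr have "gauss_map x \<noteq> 0" by auto
  ultimately show ?thesis
    using eq frac_lt_1[of "1 / x"] frac_ge_0[of "1 / x"] by (auto simp: unit_irrationals_def)
qed

lemma gauss_map_pow_unit_irrationals:
  "x \<in> unit_irrationals \<Longrightarrow> (gauss_map ^^ n) x \<in> unit_irrationals"
  by (induction n) (auto intro: gauss_map_unit_irrationals)

lemma partial_quotient_Suc: "partial_quotient (Suc n) x = \<lfloor>1 / (gauss_map ^^ n) x\<rfloor>"
  by (simp add: partial_quotient_def)

lemma gauss_map_pow_Suc_eq:
  assumes "x \<in> unit_irrationals"
  shows "(gauss_map ^^ n) x = 1 / (of_int (partial_quotient (Suc n) x) + (gauss_map ^^ Suc n) x)"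
  using gauss_map_pow_unit_irrationals[OF assms, of n]
  by (auto simp: gauss_map_def partial_quotient_Suc unit_irrationals_def)

lemma partial_quotient_ge_1:
  assumes "x \<in> unit_irrationals"
  shows "partial_quotient (Suc n) x \<ge> 1"
  using gauss_map_pow_unit_irrationals[OF assms, of n]
  by (simp add: partial_quotient_Suc unit_irrationals_def le_floor_iff)

lemma log_quotient_sum_0 [simp]: "log_quotient_sum 0 x = 0"
  by (simp add: log_quotient_sum_def)

lemma log_quotient_sum_Suc:
  "log_quotient_sum (Suc n) x = log_quotient_sum n x + ln (of_int (partial_quotient (Suc n) x))"
  by (simp add: log_quotient_sum_def)

lemma log_quotient_sum_nonneg:
  assumes "x \<in> unit_irrationals"
  shows "log_quotient_sum n x \<ge> 0"
  by (induction n) (use partial_quotient_ge_1[OF assms] in \<open>auto simp: log_quotient_sum_Suc\<close>)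

text \<open>An inverse branch u -> 1/(a + u) with a \<ge> 1 shrinks distances between positive
  numbers by a factor of at least a^2; composing n of them yields exp (2 S_n).\<close>

lemma dist_le_gauss_map_pow:
  assumes x: "x \<in> unit_irrationals" and y: "y \<in> unit_irrationals"
    and "\<And>k. k < n \<Longrightarrow> partial_quotient (Suc k) x = partial_quotient (Suc k) y"
  shows "\<bar>x - y\<bar> * exp (2 * log_quotient_sum n x) \<le> \<bar>(gauss_map ^^ n) x - (gauss_map ^^ n) y\<bar>"
  using assms(3)
proof (induction n)
  case (Suc n)
  define a where "a = real_of_int (partial_quotient (Suc n) x)"
  define u where "u = (gauss_map ^^ Suc n) x"
  define v where "v = (gauss_map ^^ Suc n) y"
  have a: "a \<ge> 1" using partial_quotient_ge_1[OF x] by (simp add: a_def)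
  have uv: "u > 0" "v > 0"
    using gauss_map_pow_unit_irrationals[OF x, of "Suc n"]
      gauss_map_pow_unit_irrationals[OF y, of "Suc n"]
    by (auto simp: u_def v_def unit_irrationals_def)
  have "(gauss_map ^^ n) x = 1 / (a + u)" "(gauss_map ^^ n) y = 1 / (a + v)"
    using gauss_map_pow_Suc_eq[OF x, of n] gauss_map_pow_Suc_eq[OF y, of n] Suc.prems[of n]
    by (simp_all add: a_def u_def v_def)
  then have "\<bar>x - y\<bar> * exp (2 * log_quotient_sum n x) \<le> \<bar>1 / (a + u) - 1 / (a + v)\<bar>"
    using Suc by simp
  then have "\<bar>x - y\<bar> * exp (2 * log_quotient_sum n x) * a\<^sup>2 \<le> \<bar>1 / (a + u) - 1 / (a + v)\<bar> * a\<^sup>2"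
    by (intro mult_right_mono) auto
  also have "1 / (a + u) - 1 / (a + v) = (v - u) / ((a + u) * (a + v))"
    using a uv by (simp add: field_simps)
  also have "\<bar>(v - u) / ((a + u) * (a + v))\<bar> * a\<^sup>2 = \<bar>u - v\<bar> * (a\<^sup>2 / ((a + u) * (a + v)))"
    using a uv by (simp add: abs_mult abs_divide)
  also have "\<dots> \<le> \<bar>u - v\<bar> * 1"
  proof (intro mult_left_mono)
    have "a * a \<le> (a + u) * (a + v)" using a uv by (intro mult_mono) auto
    then show "a\<^sup>2 / ((a + u) * (a + v)) \<le> 1"
      using a uv by (simp add: power2_eq_square)
  qed auto
  finally have "\<bar>x - y\<bar> * (exp (2 * log_quotient_sum n x) * a\<^sup>2) \<le> \<bar>u - v\<bar>" by (simp add: mult.assoc)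
  also have "a\<^sup>2 = exp (2 * ln a)"
    using a exp_ln[of a] by (simp add: exp_double)
  also have "exp (2 * log_quotient_sum n x) * \<dots> = exp (2 * log_quotient_sum (Suc n) x)"
    by (simp add: log_quotient_sum_Suc a_def exp_add[symmetric] algebra_simps)
  finally show ?case by (simp add: u_def v_def)
qed simp

text \<open>Lists of naturals form a countable type, so prefixes can index a cover and be summed
  over with counting measure. On \<open>unit_irrationals\<close> the conversion \<open>nat\<close>
  loses nothing.\<close>

definition quotient_prefix :: "nat \<Rightarrow> real \<Rightarrow> nat list" where
  "quotient_prefix n x = map (\<lambda>k. nat (partial_quotient (Suc k) x)) [0..<n]"

lemma length_quotient_prefix [simp]: "length (quotient_prefix n x) = n"
  by (simp add: quotient_prefix_def)

text \<open>The weight of a cylinder becomes a product over its prefix, so that its sum over all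
  prefixes factorises.\<close>

lemma prod_list_quotient_prefix:
  assumes "x \<in> unit_irrationals"
  shows "prod_list (map (\<lambda>a. real a powr - \<alpha>) (quotient_prefix n x)) = exp (- \<alpha> * log_quotient_sum n x)"
proof (induction n)
  case (Suc n)
  have "real (nat (partial_quotient (Suc n) x)) = real_of_int (partial_quotient (Suc n) x)"
    using partial_quotient_ge_1[OF assms, of n] by simp
  moreover have "real_of_int (partial_quotient (Suc n) x) \<ge> 1"
    using partial_quotient_ge_1[OF assms, of n] by simp
  ultimately have "real (nat (partial_quotient (Suc n) x)) powr - \<alpha>
      = exp (- \<alpha> * ln (of_int (partial_quotient (Suc n) x)))"
    by (simp add: powr_def)
  with Suc show ?case
    by (simp add: quotient_prefix_def log_quotient_sum_Suc exp_add[symmetric] algebra_simps)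
qed (simp add: quotient_prefix_def)

lemma quotient_prefix_eqD:
  assumes "quotient_prefix n x = quotient_prefix n y" "x \<in> unit_irrationals" "y \<in> unit_irrationals" "k < n"
  shows "partial_quotient (Suc k) x = partial_quotient (Suc k) y"
proof -
  have "quotient_prefix n x ! k = quotient_prefix n y ! k" using assms(1) by simp
  then show ?thesis
    using assms(4) partial_quotient_ge_1[OF assms(2), of k] partial_quotient_ge_1[OF assms(3), of k]
    by (simp add: quotient_prefix_def)
qed

lemma quotient_prefix_log_quotient_sum:
  assumes "quotient_prefix n x = quotient_prefix n y" "x \<in> unit_irrationals" "y \<in> unit_irrationals"
  shows "log_quotient_sum n x = log_quotient_sum n y"
  unfolding log_quotient_sum_def
proof (rule sum.cong)
  fix k assume "k \<in> {1..n}"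
  then show "ln (of_int (partial_quotient k x)) = ln (real_of_int (partial_quotient k y))"
    using quotient_prefix_eqD[OF assms, of "k - 1"] by auto
qed simp

text \<open>Distributivity for infinite sums, by splitting off the head. For f a = a^(-\<alpha>) it
  gives the total weight zeta(\<alpha>)^n. The length test inside the integrand lets all n share one
  index type.\<close>

lemma nn_integral_lists_of_length:
  fixes f :: "'a::countable \<Rightarrow> ennreal"
  shows "(\<integral>\<^sup>+xs. (if length xs = n then prod_list (map f xs) else 0) \<partial>count_space UNIV)
    = (\<integral>\<^sup>+a. f a \<partial>count_space UNIV) ^ n"
proof (induction n)
  case 0
  have "(\<integral>\<^sup>+xs. (if length xs = 0 then prod_list (map f xs) else 0) \<partial>count_space UNIV)
      = (\<integral>\<^sup>+xs. 1 * indicator {[] :: 'a list} xs \<partial>count_space UNIV)"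
    by (intro nn_integral_cong) (auto split: split_indicator)
  then show ?case by simp
next
  case (Suc n)
  let ?h = "\<lambda>(a, xs). f a * (if length xs = n then prod_list (map f xs) else 0)"
  let ?A = "range (\<lambda>(a, xs). a # xs) :: 'a list set"
  have A: "?A = {xs. xs \<noteq> []}"
    by (auto simp: image_iff neq_Nil_conv)
  have "(\<integral>\<^sup>+xs. (if length xs = Suc n then prod_list (map f xs) else 0) \<partial>count_space UNIV)
      = (\<integral>\<^sup>+xs. (if length xs = Suc n then prod_list (map f xs) else 0) * indicator ?A xs \<partial>count_space UNIV)"
    unfolding A by (intro nn_integral_cong) (auto split: split_indicator)
  also have "\<dots> = (\<integral>\<^sup>+xs. (if length xs = Suc n then prod_list (map f xs) else 0) \<partial>count_space ?A)"
    by (rule nn_integral_count_space_indicator[symmetric]) simp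
  also have "\<dots> = (\<integral>\<^sup>+z. (\<lambda>xs. if length xs = Suc n then prod_list (map f xs) else 0)
      ((\<lambda>(a, xs). a # xs) z) \<partial>count_space UNIV)"
    by (rule nn_integral_bij_count_space[symmetric]) (auto simp: bij_betw_def inj_on_def)
  also have "\<dots> = (\<integral>\<^sup>+z. ?h z \<partial>count_space UNIV)"
    by (intro nn_integral_cong) auto
  also have "\<dots> = (\<integral>\<^sup>+a. \<integral>\<^sup>+xs. ?h (a, xs) \<partial>count_space UNIV \<partial>count_space UNIV)"
    by (rule nn_integral_fst_count_space[symmetric])
  also have "\<dots> = (\<integral>\<^sup>+a. f a \<partial>count_space UNIV) ^ Suc n"
    by (simp add: nn_integral_cmult Suc nn_integral_multc)
  finally show ?case .
qed


section \<open>Covering by cylinders\<close>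

text \<open>The n-th Gauss image is at most 1/a_{n+1} = exp (S_n - S_{n+1}), and the first n
  branches contract by exp (- 2 S_n). The common bound \<open>L\<close> allows x and y to differ in
  a_{n+1}, so one covering set replaces many sibling cylinders.\<close>

lemma dist_le_exp_quotients:
  assumes x: "x \<in> unit_irrationals" and y: "y \<in> unit_irrationals"
    and eq: "quotient_prefix n x = quotient_prefix n y"
    and bx: "L \<le> log_quotient_sum n x + log_quotient_sum (Suc n) x"
    and b_y: "L \<le> log_quotient_sum n y + log_quotient_sum (Suc n) y"
  shows "\<bar>x - y\<bar> \<le> exp (- L)"
proof -
  define S where "S = log_quotient_sum n x"
  have S: "log_quotient_sum n y = S"
    using quotient_prefix_log_quotient_sum[OF eq x y] by (simp add: S_def)
  have bound: "0 < (gauss_map ^^ n) z \<and> (gauss_map ^^ n) z \<le> exp (2 * S - L)"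
    if z: "z \<in> unit_irrationals" "log_quotient_sum n z = S"
      and L: "L \<le> log_quotient_sum n z + log_quotient_sum (Suc n) z" for z
  proof -
    define a where "a = real_of_int (partial_quotient (Suc n) z)"
    define u where "u = (gauss_map ^^ n) z"
    have a: "a \<ge> 1" using partial_quotient_ge_1[OF z(1)] by (simp add: a_def)
    have u: "u > 0"
      using gauss_map_pow_unit_irrationals[OF z(1), of n] by (simp add: u_def unit_irrationals_def)
    have "a \<le> 1 / u" by (simp add: a_def u_def partial_quotient_Suc)
    then have "u \<le> 1 / a" using a u by (simp add: field_simps)
    also have "1 / a = exp (- ln a)" using a by (simp add: exp_minus field_simps)
    also have "\<dots> \<le> exp (2 * S - L)"
      using L z(2) by (simp add: log_quotient_sum_Suc a_def)
    finally show ?thesis using u by (simp add: u_def)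
  qed
  have "\<bar>x - y\<bar> * exp (2 * S) \<le> \<bar>(gauss_map ^^ n) x - (gauss_map ^^ n) y\<bar>"
    unfolding S_def using quotient_prefix_eqD[OF eq x y] by (intro dist_le_gauss_map_pow x y)
  also have "\<dots> \<le> exp (2 * S - L)"
    using bound[OF x S_def[symmetric] bx] bound[OF y S b_y] by linarith
  also have "\<dots> = exp (- L) * exp (2 * S)"
    by (simp add: exp_add[symmetric])
  finally show ?thesis by simp
qed

text \<open>Since \<open>S (Suc n) - S n\<close> is the logarithm of the next partial quotient, the right-hand side in
  the last hypothesis is \<open>s\<close> times the exponent in the diameter bound \<open>exp (- 2 * S n) / L\<close>. The factor
  \<open>exp (- w n)\<close> compensates the sum of \<open>exp (- \<alpha> * S n)\<close> over all prefixes of length \<open>n\<close>.\<close>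

lemma hausdorff_measure_eq_0_quotients:
  assumes A: "A \<subseteq> unit_irrationals" and "s > 0" "\<alpha> > 1"
    and summ: "summable (\<lambda>n. (\<Sum>a. real a powr - \<alpha>) ^ n * exp (- w n))"
    and freq: "\<And>x. x \<in> A \<Longrightarrow> \<exists>\<^sub>F n in sequentially.
      \<alpha> * log_quotient_sum n x + w n \<le> s * (log_quotient_sum n x + log_quotient_sum (Suc n) x)"
  shows "hausdorff_measure s A = 0"
proof (rule hausdorff_measure_eq_0I[OF \<open>s > 0\<close>])
  fix \<epsilon> :: real assume "\<epsilon> > 0"
  \<comment> \<open>\<open>0 powr - \<alpha>\<close> is 0, so the index 0 contributes nothing and
    \<open>Z\<close> is zeta(\<alpha>).\<close>
  define Z where "Z = (\<Sum>a. real a powr - \<alpha>)"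
  have sumZ: "summable (\<lambda>a. real a powr - \<alpha>)"
    using \<open>\<alpha> > 1\<close> summable_real_powr_iff[of "- \<alpha>"] by simp
  have Z0: "Z \<ge> 0" unfolding Z_def by (intro suminf_nonneg sumZ) simp
  have Z_int: "(\<integral>\<^sup>+a. ennreal (real a powr - \<alpha>) \<partial>count_space UNIV) = ennreal Z"
    unfolding nn_integral_count_space_nat Z_def by (intro suminf_ennreal2 sumZ) simp
  \<comment> \<open>Only prefixes of length at least \<open>N\<close> enter the cover, so its total
    is bounded by a tail of the convergent series.\<close>
  obtain N where N: "norm (\<Sum>i. Z ^ (i + N) * exp (- w (i + N))) < \<epsilon>"
    using suminf_exist_split[OF \<open>\<epsilon> > 0\<close> summ] by (auto simp: Z_def)
  define D where "D n x \<longleftrightarrow> \<alpha> * log_quotient_sum n x + w n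
      \<le> s * (log_quotient_sum n x + log_quotient_sum (Suc n) x)" for n x
  define U where "U xs = {x \<in> A. N \<le> length xs \<and> quotient_prefix (length xs) x = xs \<and> D (length xs) x}" for xs
  \<comment> \<open>For fixed \<open>xs\<close> at most the term n = \<open>length xs\<close> is
    nonzero; writing the bound as a series lets the sum over lists be exchanged with the sum over
    lengths.\<close>
  define h where "h n xs = ennreal (exp (- w n)) *
      (if length xs = n then prod_list (map (\<lambda>a. ennreal (real a powr - \<alpha>)) xs) else 0)" for n xs
  have U_bound: "diam_pow s (U xs) \<le> (\<Sum>n. h (n + N) xs)" for xs
  proof (cases "U xs = {}")
    case False
    define n where "n = length xs"
    from False obtain x0 where x0: "x0 \<in> U xs" by blast
    have "N \<le> n" using x0 by (simp add: U_def n_def)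
    define S where "S = log_quotient_sum n x0"
    \<comment> \<open>Chosen so that the s-th power of the diameter bound exp (- L) is exp (-
      \<alpha> S) exp (- w n).\<close>
    define L where "L = (\<alpha> * S + w n) / s"
    have U_S: "x \<in> unit_irrationals \<and> quotient_prefix n x = quotient_prefix n x0 \<and>
        L \<le> log_quotient_sum n x + log_quotient_sum (Suc n) x" if "x \<in> U xs" for x
    proof -
      have 1: "x \<in> unit_irrationals" "x0 \<in> unit_irrationals" "quotient_prefix n x = quotient_prefix n x0" "D n x"
        using x0 that A by (auto simp: U_def n_def)
      moreover have "log_quotient_sum n x = S"
        unfolding S_def by (intro quotient_prefix_log_quotient_sum 1)
      ultimately show ?thesis
        using \<open>s > 0\<close> by (simp add: D_def L_def divide_le_eq mult.commute)
    qed
    have "norm (x - y) \<le> exp (- L)" if "x \<in> U xs" "y \<in> U xs" for x y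
      using dist_le_exp_quotients[of x y n L] U_S[OF that(1)] U_S[OF that(2)] by simp
    then have "diameter (U xs) \<le> exp (- L)"
      by (intro diameter_le) auto
    moreover have "bounded (U xs)"
      by (rule bounded_subset[of "{0..1}"]) (use A in \<open>auto simp: U_def unit_irrationals_def\<close>)
    ultimately have "diameter (U xs) powr s \<le> exp (- L) powr s"
      using \<open>s > 0\<close> by (intro powr_mono2 diameter_ge_0) auto
    also have "\<dots> = exp (- \<alpha> * S) * exp (- w n)"
      using \<open>s > 0\<close> by (simp add: powr_def L_def exp_add[symmetric])
    also have "exp (- \<alpha> * S) = prod_list (map (\<lambda>a. real a powr - \<alpha>) xs)"
      using x0 A prod_list_quotient_prefix[of x0 \<alpha> n] unfolding S_def by (auto simp: U_def n_def)
    finally have "diam_pow s (U xs) \<le> ennreal (prod_list (map (\<lambda>a. real a powr - \<alpha>) xs) * exp (- w n))"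
      using False \<open>s > 0\<close> by (auto simp: diam_pow_def intro: ennreal_leI)
    also have "\<dots> = h (n - N + N) xs"
    proof -
      have "prod_list (map (\<lambda>a. ennreal (real a powr - \<alpha>)) ys)
          = ennreal (prod_list (map (\<lambda>a. real a powr - \<alpha>) ys))
        \<and> 0 \<le> prod_list (map (\<lambda>a. real a powr - \<alpha>) ys)" for ys
        by (induction ys) (auto simp: ennreal_mult)
      then show ?thesis using \<open>N \<le> n\<close> by (auto simp: h_def n_def ennreal_mult mult.commute)
    qed
    also have "\<dots> \<le> (\<Sum>n. h (n + N) xs)"
      using sum_le_suminf[of "\<lambda>n. h (n + N) xs" "{n - N}"] by simp
    finally show ?thesis .
  qed (simp add: diam_pow_def)
  define e :: "nat \<Rightarrow> nat list" where "e = from_nat_into UNIV"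
  have e: "bij_betw e UNIV UNIV"
    unfolding e_def by (intro bij_betw_from_nat_into infinite_UNIV_listI) auto
  have "A \<subseteq> (\<Union>i. U (e i))"
  proof
    fix x assume "x \<in> A"
    then obtain n where n: "n \<ge> N" "D n x"
      using freq[OF \<open>x \<in> A\<close>] unfolding frequently_sequentially D_def by blast
    obtain i where "e i = quotient_prefix n x"
      using e by (metis UNIV_I bij_betw_def imageE)
    then have "x \<in> U (e i)" using n \<open>x \<in> A\<close> by (simp add: U_def)
    then show "x \<in> (\<Union>i. U (e i))" by blast
  qed
  moreover have "bounded (U (e i))" for i
    by (rule bounded_subset[of "{0..1}"]) (use A in \<open>auto simp: U_def unit_irrationals_def\<close>)
  moreover have "(\<Sum>i. diam_pow s (U (e i))) \<le> ennreal \<epsilon>"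
  proof -
    have "(\<Sum>i. diam_pow s (U (e i))) = (\<integral>\<^sup>+i. diam_pow s (U (e i)) \<partial>count_space UNIV)"
      by (simp add: nn_integral_count_space_nat)
    also have "\<dots> = (\<integral>\<^sup>+xs. diam_pow s (U xs) \<partial>count_space UNIV)"
      by (rule nn_integral_bij_count_space[OF e])
    also have "\<dots> \<le> (\<integral>\<^sup>+xs. (\<Sum>n. h (n + N) xs) \<partial>count_space UNIV)"
      by (intro nn_integral_mono U_bound)
    also have "\<dots> = (\<Sum>n. \<integral>\<^sup>+xs. h (n + N) xs \<partial>count_space UNIV)"
      by (intro nn_integral_suminf) auto
    also have "\<dots> = (\<Sum>n. ennreal (Z ^ (n + N) * exp (- w (n + N))))"
      by (simp only: h_def nn_integral_cmult[OF borel_measurable_count_space] nn_integral_lists_of_length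
          Z_int ennreal_power[OF Z0] ennreal_mult''[symmetric] exp_ge_zero mult.commute zero_le_power[OF Z0])
    also have "\<dots> = ennreal (\<Sum>n. Z ^ (n + N) * exp (- w (n + N)))"
      using summ Z0 by (intro suminf_ennreal2) (auto simp: Z_def summable_iff_shift[of "\<lambda>n. Z ^ n * exp (- w n)" N, unfolded Z_def])
    also have "\<dots> \<le> ennreal \<epsilon>"
      using N by (intro ennreal_leI) auto
    finally show ?thesis .
  qed
  ultimately show "\<exists>U. A \<subseteq> (\<Union>i. U i) \<and> (\<forall>i. bounded (U i)) \<and> (\<Sum>i. diam_pow s (U i)) \<le> ennreal \<epsilon>"
    by (intro exI[of _ "\<lambda>i. U (e i)"]) auto
qed

text \<open>With 1 < \<alpha> < 2s, the sum of exp (- 2 s S_n) over prefixes has a surplus exponent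
  (2s - \<alpha>) S_n, and S_n \<ge> M n beats zeta(\<alpha>)^n once M is large. The contribution of
  a_{n+1} is simply dropped.\<close>

lemma hausdorff_measure_eq_0_linear_growth:
  assumes "A \<subseteq> unit_irrationals" "s > 1 / 2"
    and freq: "\<And>x M. x \<in> A \<Longrightarrow> \<exists>\<^sub>F n in sequentially. M * real n \<le> log_quotient_sum n x"
  shows "hausdorff_measure s A = 0"
proof -
  define \<alpha> where "\<alpha> = (2 * s + 1) / 2"
  have \<alpha>: "\<alpha> > 1" "\<alpha> < 2 * s" using assms(2) by (auto simp: \<alpha>_def)
  define Z where "Z = (\<Sum>a. real a powr - \<alpha>)"
  have Z0: "Z \<ge> 0" unfolding Z_def
    using \<alpha> summable_real_powr_iff[of "- \<alpha>"] by (intro suminf_nonneg) auto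
  \<comment> \<open>This makes exp (- w n) equal to (2 (Z + 1))^(-n), so the series to be summed is
    geometric with ratio Z / (2 (Z + 1)) < 1.\<close>
  define M where "M = ln (2 * (Z + 1)) / (2 * s - \<alpha>)"
  have M: "(2 * s - \<alpha>) * M = ln (2 * (Z + 1))" using \<alpha> by (simp add: M_def)
  show ?thesis
  proof (rule hausdorff_measure_eq_0_quotients[where \<alpha> = \<alpha> and w = "\<lambda>n. (2 * s - \<alpha>) * (M * real n)"])
    have "(2 * s - \<alpha>) * (M * real n) = real n * ln (2 * (Z + 1))" for n
      using M by (metis mult.assoc mult.commute)
    then have "exp (- ((2 * s - \<alpha>) * (M * real n))) = (1 / (2 * (Z + 1))) ^ n" for n
      using Z0 by (simp add: exp_minus exp_of_nat_mult power_divide field_simps)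
    then have eq: "Z ^ n * exp (- ((2 * s - \<alpha>) * (M * real n))) = (Z / (2 * (Z + 1))) ^ n" for n
      by (simp add: power_divide)
    have "norm (Z / (2 * (Z + 1))) < 1" using Z0 by (simp add: field_simps)
    then show "summable (\<lambda>n. (\<Sum>a. real a powr - \<alpha>) ^ n * exp (- ((2 * s - \<alpha>) * (M * real n))))"
      unfolding Z_def[symmetric] eq by (rule summable_geometric)
  next
    fix x assume x: "x \<in> A"
    show "\<exists>\<^sub>F n in sequentially. \<alpha> * log_quotient_sum n x + (2 * s - \<alpha>) * (M * real n)
        \<le> s * (log_quotient_sum n x + log_quotient_sum (Suc n) x)"
      using freq[OF x, of M]
    proof (rule frequently_mono[rotated], safe)
      fix n assume n: "M * real n \<le> log_quotient_sum n x"
      have "x \<in> unit_irrationals" using x assms(1) by blast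
      then have "log_quotient_sum n x \<le> log_quotient_sum (Suc n) x"
        using partial_quotient_ge_1[of x n] by (simp add: log_quotient_sum_Suc)
      then have "s * (2 * log_quotient_sum n x) \<le> s * (log_quotient_sum n x + log_quotient_sum (Suc n) x)"
        using assms(2) by (intro mult_left_mono) auto
      moreover have "(2 * s - \<alpha>) * (M * real n) \<le> (2 * s - \<alpha>) * log_quotient_sum n x"
        using n \<alpha> by (intro mult_left_mono) auto
      ultimately show "\<alpha> * log_quotient_sum n x + (2 * s - \<alpha>) * (M * real n)
        \<le> s * (log_quotient_sum n x + log_quotient_sum (Suc n) x)"
        by (simp add: algebra_simps)
    qed
  qed (use assms \<alpha> in auto)
qed

text \<open>Without jumps from \<open>N\<close> on, induction gives S n \<le> K c'^n:
  \<open>K\<close> \<ge> 1 absorbs the second entry of the maximum, and S N / c'^N starts the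
  induction. This contradicts c^n \<le> S n for infinitely many n, as c > c'.\<close>

lemma frequently_exponential_jump:
  fixes S :: "nat \<Rightarrow> real"
  assumes "1 < c'" "c' < c" and freq: "\<exists>\<^sub>F n in sequentially. c ^ n \<le> S n"
  shows "\<exists>\<^sub>F n in sequentially. c' * max (S n) (c' ^ n) \<le> S (Suc n)"
proof (rule ccontr)
  assume "\<not> ?thesis"
  then obtain N where N: "\<And>n. n \<ge> N \<Longrightarrow> S (Suc n) < c' * max (S n) (c' ^ n)"
    unfolding not_frequently eventually_sequentially not_le by blast
  define K where "K = max 1 (S N / c' ^ N)"
  have K: "S (N + k) \<le> K * c' ^ (N + k)" for k
  proof (induction k)
    case 0
    have "S N = S N / c' ^ N * c' ^ N" using assms by simp
    also have "\<dots> \<le> K * c' ^ N" using assms by (intro mult_right_mono) (auto simp: K_def)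
    finally show ?case by simp
  next
    case (Suc k)
    have "1 * c' ^ (N + k) \<le> K * c' ^ (N + k)"
      using assms by (intro mult_right_mono) (auto simp: K_def)
    then have "c' * max (S (N + k)) (c' ^ (N + k)) \<le> c' * (K * c' ^ (N + k))"
      using Suc assms by (intro mult_left_mono) auto
    with N[of "N + k"] show ?case by (simp add: mult.left_commute)
  qed
  define q where "q = c / c'"
  have "q > 1" using assms by (simp add: q_def)
  then have "filterlim (\<lambda>n. q ^ n) at_top sequentially" by real_asymp
  then have "\<forall>\<^sub>F n in sequentially. q ^ n > K \<and> n \<ge> N"
    by (simp add: filterlim_at_top_dense eventually_conj eventually_ge_at_top)
  then have "\<exists>\<^sub>F n in sequentially. c ^ n \<le> S n \<and> q ^ n > K \<and> n \<ge> N"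
    using freq frequently_eventually_conj by (fastforce simp: conj_commute)
  then obtain n where n: "c ^ n \<le> S n" "q ^ n > K" "n \<ge> N"
    using frequently_ex by fastforce
  have "K * c' ^ n < c ^ n"
    using n(2) assms by (simp add: q_def power_divide field_simps)
  with n K[of "n - N"] show False by simp
qed

text \<open>At a jump, S_n + S_{n+1} is at least S_n + c' max (S_n, c'^n). One share of the maximum
  pays for \<alpha> S_n, the other leaves a weight of order c'^n, which dominates
  zeta(\<alpha>)^n.\<close>

lemma hausdorff_measure_eq_0_exponential_growth:
  assumes A: "A \<subseteq> unit_irrationals" and "c > 1" "s > 1 / (c + 1)"
    and freq: "\<And>x. x \<in> A \<Longrightarrow> \<exists>\<^sub>F n in sequentially. c ^ n \<le> log_quotient_sum n x"
  shows "hausdorff_measure s A = 0"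
proof -
  have "0 < 1 / (c + 1)" using \<open>c > 1\<close> by simp
  with assms have "s > 0" by linarith
  have sc: "1 / s - 1 < c" using assms \<open>s > 0\<close> by (simp add: field_simps)
  \<comment> \<open>c' > 1/s - 1 means s (1 + c') > 1, which leaves room for some \<alpha> > 1 below
    s (1 + c').\<close>
  obtain c' where c': "c' < c" "c' > max 1 (1 / s - 1)"
    using dense[of "max 1 (1 / s - 1)" c] \<open>c > 1\<close> sc by auto
  then have "c' > 1" "1 / s < 1 + c'" by auto
  then have "s * (1 + c') > 1" using \<open>s > 0\<close> by (simp add: field_simps)
  then obtain \<alpha> where \<alpha>: "\<alpha> > 1" "\<alpha> < s * (1 + c')" "\<alpha> > s"
  proof -
    have "max 1 s < s * (1 + c')"
      using \<open>s * (1 + c') > 1\<close> \<open>s > 0\<close> \<open>c' > 1\<close> by (simp add: field_simps)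
    from dense[OF this] show ?thesis using that by auto
  qed
  \<comment> \<open>The share of the maximum spent on S_n, determined by s (1 + c' \<kappa>) =
    \<alpha>. It lies in (0,1) exactly because s < \<alpha> < s (1 + c').\<close>
  define \<kappa> where "\<kappa> = (\<alpha> - s) / (s * c')"
  have \<kappa>: "\<kappa> > 0" "\<kappa> < 1" "\<alpha> = s + s * c' * \<kappa>"
    using \<alpha> \<open>s > 0\<close> \<open>c' > 1\<close> by (auto simp: \<kappa>_def field_simps)
  define Z where "Z = (\<Sum>a. real a powr - \<alpha>)"
  have Z0: "Z \<ge> 0" unfolding Z_def
    using \<alpha> summable_real_powr_iff[of "- \<alpha>"] by (intro suminf_nonneg) auto
  define w where "w n = s * (1 - \<kappa>) * c' ^ Suc n" for n
  show ?thesis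
  proof (rule hausdorff_measure_eq_0_quotients[where \<alpha> = \<alpha> and w = w])
    define r where "r = ln (2 * (Z + 1))"
    have "filterlim (\<lambda>n. s * (1 - \<kappa>) * c' ^ Suc n - real n * r) at_top sequentially"
      using \<open>s > 0\<close> \<kappa> \<open>c' > 1\<close> by real_asymp
    then have "\<forall>\<^sub>F n in sequentially. 0 \<le> s * (1 - \<kappa>) * c' ^ Suc n - real n * r"
      unfolding filterlim_at_top by blast
    then have ev: "\<forall>\<^sub>F n in sequentially. norm (Z ^ n * exp (- w n)) \<le> (Z / (2 * (Z + 1))) ^ n"
    proof eventually_elim
      case (elim n)
      have "exp (- w n) \<le> exp (- (real n * r))" using elim by (simp add: w_def)
      also have "\<dots> = (1 / (2 * (Z + 1))) ^ n"
        using Z0 by (simp add: r_def exp_minus exp_of_nat_mult power_divide field_simps)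
      finally have "Z ^ n * exp (- w n) \<le> Z ^ n * (1 / (2 * (Z + 1))) ^ n"
        using Z0 by (intro mult_left_mono) auto
      then show ?case using Z0 by (simp add: power_divide)
    qed
    have "norm (Z / (2 * (Z + 1))) < 1" using Z0 by (simp add: field_simps)
    then show "summable (\<lambda>n. (\<Sum>a. real a powr - \<alpha>) ^ n * exp (- w n))"
      unfolding Z_def[symmetric] by (intro summable_comparison_test_ev[OF ev] summable_geometric)
  next
    fix x assume x: "x \<in> A"
    show "\<exists>\<^sub>F n in sequentially. \<alpha> * log_quotient_sum n x + w n
        \<le> s * (log_quotient_sum n x + log_quotient_sum (Suc n) x)"
      using frequently_exponential_jump[OF \<open>c' > 1\<close> \<open>c' < c\<close> freq[OF x]]
    proof (rule frequently_mono[rotated], safe)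
      fix n
      define S where "S = log_quotient_sum n x"
      assume "c' * max (log_quotient_sum n x) (c' ^ n) \<le> log_quotient_sum (Suc n) x"
      then have m: "c' * max S (c' ^ n) \<le> log_quotient_sum (Suc n) x" by (simp add: S_def)
      have "\<kappa> * S + (1 - \<kappa>) * c' ^ n \<le> \<kappa> * max S (c' ^ n) + (1 - \<kappa>) * max S (c' ^ n)"
        using \<kappa> by (intro add_mono mult_left_mono) auto
      also have "\<dots> = max S (c' ^ n)" by (simp add: algebra_simps)
      finally have "c' * (\<kappa> * S + (1 - \<kappa>) * c' ^ n) \<le> c' * max S (c' ^ n)"
        using \<open>c' > 1\<close> by (intro mult_left_mono) auto
      with m have "s * (S + c' * (\<kappa> * S + (1 - \<kappa>) * c' ^ n)) \<le> s * (S + log_quotient_sum (Suc n) x)"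
        using \<open>s > 0\<close> by (intro mult_left_mono add_mono) auto
      then show "\<alpha> * log_quotient_sum n x + w n
          \<le> s * (log_quotient_sum n x + log_quotient_sum (Suc n) x)"
        by (simp add: S_def[symmetric] \<kappa>(3) w_def algebra_simps)
    qed
  qed (use A \<alpha> \<open>s > 0\<close> in auto)
qed


section \<open>Irrationals with prescribed partial quotients\<close>

text \<open>The truncation of [a 0, a 1, ...] after n quotients. Peeling off the first quotient
  matches one step of the Gauss map; \<open>a k\<close> will be the partial quotient of index k +
  1.\<close>

primrec cf_approx :: "nat \<Rightarrow> (nat \<Rightarrow> nat) \<Rightarrow> real" where
  "cf_approx 0 a = 0"
| "cf_approx (Suc n) a = 1 / (real (a 0) + cf_approx n (\<lambda>k. a (Suc k)))"

definition cf_value :: "(nat \<Rightarrow> nat) \<Rightarrow> real" where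
  "cf_value a = lim (\<lambda>n. cf_approx n a)"

lemma cf_approx_bounds:
  assumes "\<And>k. a k \<ge> 2"
  shows "0 \<le> cf_approx n a" "cf_approx n a \<le> 1 / 2"
proof -
  have "0 \<le> cf_approx n a \<and> cf_approx n a \<le> 1 / 2"
    using assms
  proof (induction n arbitrary: a)
    case (Suc n)
    have "0 \<le> cf_approx n (\<lambda>k. a (Suc k))" 
      using Suc.IH[of "\<lambda>k. a (Suc k)"] Suc.prems by simp
    moreover have "real (a 0) \<ge> 2" using Suc.prems[of 0] by simp
    ultimately show ?case by (auto simp: field_simps)
  qed simp
  then show "0 \<le> cf_approx n a" "cf_approx n a \<le> 1 / 2" by auto
qed

text \<open>With a \<ge> 2 each branch u -> 1/(a + u) contracts nonnegative numbers by 1/4, which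
  gives convergence without recurrences for convergents.\<close>

lemma cf_approx_diff:
  assumes "\<And>k. a k \<ge> 2"
  shows "\<bar>cf_approx (Suc n) a - cf_approx n a\<bar> \<le> (1 / 4) ^ n"
  using assms
proof (induction n arbitrary: a)
  case 0
  have "real (a 0) \<ge> 2" using 0[of 0] by simp
  then show ?case by simp
next
  case (Suc n)
  define p where "p = cf_approx (Suc n) (\<lambda>k. a (Suc k))"
  define q where "q = cf_approx n (\<lambda>k. a (Suc k))"
  have "p \<ge> 0" "q \<ge> 0" unfolding p_def q_def by (rule cf_approx_bounds, rule Suc.prems)+
  have a: "real (a 0) \<ge> 2" using Suc.prems[of 0] by simp
  have "1 / (a 0 + p) - 1 / (a 0 + q) = (q - p) / ((a 0 + p) * (a 0 + q))"
    using a \<open>p \<ge> 0\<close> \<open>q \<ge> 0\<close> by (simp add: field_simps)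
  also have "\<bar>\<dots>\<bar> = \<bar>p - q\<bar> / ((a 0 + p) * (a 0 + q))"
    using a \<open>p \<ge> 0\<close> \<open>q \<ge> 0\<close> by (simp add: abs_mult)
  also have "\<dots> \<le> \<bar>p - q\<bar> / 4"
  proof -
    have "2 * 2 \<le> (a 0 + p) * (a 0 + q)" using a \<open>p \<ge> 0\<close> \<open>q \<ge> 0\<close> by (intro mult_mono) auto
    then show ?thesis by (intro divide_left_mono) (auto intro!: mult_pos_pos)
  qed
  also have "\<dots> \<le> (1 / 4) ^ n / 4"
    unfolding p_def q_def by (intro divide_right_mono Suc.IH Suc.prems) simp
  finally show ?case by (simp add: p_def q_def)
qed

lemma cf_approx_tendsto:
  assumes "\<And>k. a k \<ge> 2"
  shows "(\<lambda>n. cf_approx n a) \<longlonglongrightarrow> cf_value a"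
proof -
  have "summable (\<lambda>n. cf_approx (Suc n) a - cf_approx n a)"
  proof (rule summable_comparison_test')
    show "summable (\<lambda>n. (1 / 4 :: real) ^ n)" by (rule summable_geometric) simp
    show "norm (cf_approx (Suc n) a - cf_approx n a) \<le> (1 / 4) ^ n" for n
      using cf_approx_diff[of a, OF assms, of n] by (simp del: cf_approx.simps)
  qed
  then have "convergent (\<lambda>n. \<Sum>k<n. cf_approx (Suc k) a - cf_approx k a)"
    by (simp add: summable_iff_convergent)
  then have "convergent (\<lambda>n. cf_approx n a)"
    unfolding sum_lessThan_telescope[of "\<lambda>n. cf_approx n a"] by simp
  then show ?thesis
    by (simp add: cf_value_def convergent_LIMSEQ_iff)
qed

lemma cf_value_bounds:
  assumes "\<And>k. a k \<ge> 2"
  shows "0 \<le> cf_value a" "cf_value a \<le> 1 / 2"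
proof -
  note lim = cf_approx_tendsto[of a, OF assms]
  show "0 \<le> cf_value a"
    using cf_approx_bounds(1)[of a, OF assms] by (intro LIMSEQ_le_const[OF lim]) simp
  show "cf_value a \<le> 1 / 2"
    using cf_approx_bounds(2)[of a, OF assms] by (intro LIMSEQ_le_const2[OF lim]) simp
qed

lemma cf_value_unfold:
  assumes "\<And>k. a k \<ge> 2"
  shows "cf_value a = 1 / (real (a 0) + cf_value (\<lambda>k. a (Suc k)))"
proof -
  have "(\<lambda>n. cf_approx n (\<lambda>k. a (Suc k))) \<longlonglongrightarrow> cf_value (\<lambda>k. a (Suc k))"
    by (intro cf_approx_tendsto assms)
  moreover have "real (a 0) + cf_value (\<lambda>k. a (Suc k)) \<noteq> 0"
    using cf_value_bounds(1)[of "\<lambda>k. a (Suc k)", OF assms] assms[of 0] by simp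
  ultimately have "(\<lambda>n. cf_approx (Suc n) a) \<longlonglongrightarrow> 1 / (real (a 0) + cf_value (\<lambda>k. a (Suc k)))"
    unfolding cf_approx.simps by (intro tendsto_intros)
  then show ?thesis
    by (rule LIMSEQ_unique[OF LIMSEQ_Suc[OF cf_approx_tendsto[of a, OF assms]]])
qed

lemma cf_value_pos:
  assumes "\<And>k. a k \<ge> 2"
  shows "0 < cf_value a"
proof -
  have "0 \<le> cf_value (\<lambda>k. a (Suc k))" by (rule cf_value_bounds, rule assms)
  then show ?thesis unfolding cf_value_unfold[of a, OF assms] using assms[of 0] by simp
qed

lemma gauss_map_cf_value:
  assumes "\<And>k. a k \<ge> 2"
  shows "\<lfloor>1 / cf_value a\<rfloor> = int (a 0)" "gauss_map (cf_value a) = cf_value (\<lambda>k. a (Suc k))"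
proof -
  have b: "0 \<le> cf_value (\<lambda>k. a (Suc k))" "cf_value (\<lambda>k. a (Suc k)) \<le> 1 / 2"
    by (rule cf_value_bounds, rule assms)+
  have eq: "1 / cf_value a = real (a 0) + cf_value (\<lambda>k. a (Suc k))"
    by (simp add: cf_value_unfold[of a, OF assms])
  then show fl: "\<lfloor>1 / cf_value a\<rfloor> = int (a 0)"
    using b by (simp add: floor_eq_iff)
  show "gauss_map (cf_value a) = cf_value (\<lambda>k. a (Suc k))"
    using cf_value_pos[of a, OF assms] eq fl by (simp add: gauss_map_def)
qed

lemma gauss_map_pow_cf_value:
  assumes "\<And>k. a k \<ge> 2"
  shows "(gauss_map ^^ n) (cf_value a) = cf_value (\<lambda>k. a (n + k))"
proof (induction n)
  case (Suc n)
  have "gauss_map (cf_value (\<lambda>k. a (n + k))) = cf_value (\<lambda>k. a (n + Suc k))"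
    by (rule gauss_map_cf_value) (rule assms)
  with Suc show ?case by simp
qed simp

lemma partial_quotient_cf_value:
  assumes "\<And>k. a k \<ge> 2"
  shows "partial_quotient (Suc n) (cf_value a) = int (a n)"
  using gauss_map_cf_value(1)[of "\<lambda>k. a (n + k)"] assms
  by (simp add: partial_quotient_Suc gauss_map_pow_cf_value[of a, OF assms])

text \<open>Euclidean descent: if the value is p/q, then p < q and the tail is (q - a 0 p)/p, again
  a value of the same kind, with smaller denominator.\<close>

lemma cf_value_irrational:
  assumes "\<And>k. a k \<ge> 2"
  shows "cf_value a \<notin> \<rat>"
proof
  assume "cf_value a \<in> \<rat>"
  then obtain p q :: nat where "q \<noteq> 0" "\<bar>cf_value a\<bar> = real p / real q"
    by (rule Rats_abs_nat_div_natE)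
  then have "cf_value a = real p / real q" using cf_value_bounds(1)[of a, OF assms] by simp
  then show False
    using \<open>q \<noteq> 0\<close> assms
  proof (induction q arbitrary: a p rule: less_induct)
    case (less q)
    define r where "r = cf_value (\<lambda>k. a (Suc k))"
    have r: "0 < r"
      unfolding r_def by (rule cf_value_pos) (rule less.prems)
    have x: "0 < cf_value a" "cf_value a \<le> 1 / 2"
      using cf_value_pos[of a, OF less.prems(3)] cf_value_bounds[of a, OF less.prems(3)] by auto
    then have "p \<noteq> 0" "p < q" using less.prems(1,2) by (auto simp: field_simps)
    have "1 / cf_value a = real (a 0) + r"
      using cf_value_unfold[of a, OF less.prems(3)] by (simp add: r_def)
    then have eq: "r = (real q - real (a 0) * real p) / real p"
      using less.prems(1,2) \<open>p \<noteq> 0\<close> by (simp add: field_simps)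
    then have "real (a 0 * p) \<le> real q" using r \<open>p \<noteq> 0\<close> by (simp add: zero_less_divide_iff)
    then have "a 0 * p \<le> q" by (simp only: of_nat_le_iff)
    then have "r = real (q - a 0 * p) / real p" using eq by (simp add: of_nat_diff)
    then show False
      using less.IH[OF \<open>p < q\<close>, of "\<lambda>k. a (Suc k)" "q - a 0 * p"] \<open>p \<noteq> 0\<close> less.prems(3)
      by (simp add: r_def)
  qed
qed

lemma cf_value_in_unit_irrationals:
  assumes "\<And>k. a k \<ge> 2"
  shows "cf_value a \<in> unit_irrationals"
  using cf_value_pos[of a, OF assms] cf_value_bounds(2)[of a, OF assms] cf_value_irrational[of a, OF assms]
  by (auto simp: unit_irrationals_def)

text \<open>Partial quotients at least 2 keep the tails in \<open>{0..1/2}\<close>, so that points with adjacent partial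
  quotients stay apart.\<close>

lemma cf_value_separation:
  assumes "\<And>k. a k \<ge> 2" "\<And>k. b k \<ge> 2" "\<And>k. k < n \<Longrightarrow> a k = b k" "a n \<noteq> b n"
    and "\<And>k. real (a k) + 1 \<le> M k" "\<And>k. real (b k) + 1 \<le> M k"
  shows "\<bar>real (a n) - real (b n)\<bar> / 2 / (\<Prod>k\<le>n. (M k)\<^sup>2) \<le> \<bar>cf_value a - cf_value b\<bar>"
  using assms
proof (induction n arbitrary: a b M)
  case 0
  define p where "p = cf_value (\<lambda>k. a (Suc k))"
  define q where "q = cf_value (\<lambda>k. b (Suc k))"
  have pq: "0 \<le> p" "p \<le> 1 / 2" "0 \<le> q" "q \<le> 1 / 2"
    unfolding p_def q_def by (rule cf_value_bounds, rule "0.prems")+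
  have ab: "real (a 0) \<ge> 2" "real (b 0) \<ge> 2" using "0.prems"(1)[of 0] "0.prems"(2)[of 0] by auto
  have "1 \<le> \<bar>real (a 0) - real (b 0)\<bar>" using \<open>a 0 \<noteq> b 0\<close> by linarith
  \<comment> \<open>The integers differ by at least 1 and the tails by at most 1/2, so half of the
    integer difference survives.\<close>
  have num: "\<bar>real (a 0) - real (b 0)\<bar> / 2 \<le> \<bar>(b 0 + q) - (a 0 + p)\<bar>"
  proof -
    have "\<bar>q - p\<bar> \<le> 1 / 2" unfolding abs_le_iff using pq by linarith
    moreover have "\<bar>real (a 0) - real (b 0)\<bar> \<le> \<bar>(b 0 + q) - (a 0 + p)\<bar> + \<bar>q - p\<bar>"
      by linarith
    moreover note \<open>1 \<le> \<bar>real (a 0) - real (b 0)\<bar>\<close>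
    ultimately show ?thesis by (simp add: field_simps)
  qed
  have "(a 0 + p) * (b 0 + q) \<le> M 0 * M 0"
    using pq ab "0.prems"(5)[of 0] "0.prems"(6)[of 0] by (intro mult_mono) auto
  then have "\<bar>real (a 0) - real (b 0)\<bar> / 2 / (M 0 * M 0) \<le> \<bar>(b 0 + q) - (a 0 + p)\<bar> / ((a 0 + p) * (b 0 + q))"
    using pq ab by (intro frac_le num) (auto intro!: mult_pos_pos)
  also have "\<dots> = \<bar>1 / (a 0 + p) - 1 / (b 0 + q)\<bar>"
  proof -
    have "1 / (a 0 + p) - 1 / (b 0 + q) = ((b 0 + q) - (a 0 + p)) / ((a 0 + p) * (b 0 + q))"
      using pq ab by (simp add: field_simps)
    then show ?thesis using pq ab by (simp add: abs_divide abs_mult)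
  qed
  also have "\<dots> = \<bar>cf_value a - cf_value b\<bar>"
    using cf_value_unfold[of a, OF "0.prems"(1)] cf_value_unfold[of b, OF "0.prems"(2)] by (simp add: p_def q_def)
  finally show ?case by (simp add: power2_eq_square)
next
  case (Suc n)
  define p where "p = cf_value (\<lambda>k. a (Suc k))"
  define q where "q = cf_value (\<lambda>k. b (Suc k))"
  have pq: "0 \<le> p" "p \<le> 1 / 2" "0 \<le> q" "q \<le> 1 / 2"
    unfolding p_def q_def by (rule cf_value_bounds, rule Suc.prems)+
  have a: "real (a 0) \<ge> 2" "a 0 = b 0" using Suc.prems(1)[of 0] Suc.prems(3)[of 0] by auto
  have "(a 0 + p) * (a 0 + q) \<le> M 0 * M 0"
    using pq a Suc.prems(5)[of 0] by (intro mult_mono) auto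
  have "\<bar>real (a (Suc n)) - real (b (Suc n))\<bar> / 2 / (\<Prod>k\<le>n. (M (Suc k))\<^sup>2) \<le> \<bar>p - q\<bar>"
    unfolding p_def q_def
    by (rule Suc.IH[of "\<lambda>k. a (Suc k)" "\<lambda>k. b (Suc k)" "\<lambda>k. M (Suc k)"]) (rule Suc.prems | simp add: Suc.prems(3))+
  then have "\<bar>real (a (Suc n)) - real (b (Suc n))\<bar> / 2 / (\<Prod>k\<le>n. (M (Suc k))\<^sup>2) / (M 0 * M 0)
      \<le> \<bar>p - q\<bar> / ((a 0 + p) * (a 0 + q))"
    using pq a \<open>(a 0 + p) * (a 0 + q) \<le> M 0 * M 0\<close>
    by (intro frac_le) (auto intro!: mult_pos_pos)
  also have "\<dots> = \<bar>1 / (a 0 + p) - 1 / (a 0 + q)\<bar>"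
  proof -
    have "1 / (a 0 + p) - 1 / (a 0 + q) = (q - p) / ((a 0 + p) * (a 0 + q))"
      using pq a by (simp add: field_simps)
    then show ?thesis using pq a by (simp add: abs_divide abs_mult)
  qed
  also have "\<dots> = \<bar>cf_value a - cf_value b\<bar>"
    using cf_value_unfold[of a, OF Suc.prems(1)] cf_value_unfold[of b, OF Suc.prems(2)] a by (simp add: p_def q_def)
  finally show ?case
    by (simp add: prod.atMost_Suc_shift power2_eq_square mult.commute del: prod.atMost_Suc)
qed

section \<open>Mixed radix digits of points of [0,1)\<close>

primrec radix_rem :: "(nat \<Rightarrow> nat) \<Rightarrow> real \<Rightarrow> nat \<Rightarrow> real" where
  "radix_rem m t 0 = t"
| "radix_rem m t (Suc n) = frac (real (m n) * radix_rem m t n)"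

definition radix_digit :: "(nat \<Rightarrow> nat) \<Rightarrow> real \<Rightarrow> nat \<Rightarrow> nat" where
  "radix_digit m t n = nat \<lfloor>real (m n) * radix_rem m t n\<rfloor>"

lemma radix_rem_bounds: "t \<in> {0..<1} \<Longrightarrow> radix_rem m t n \<in> {0..<1}"
  by (cases n) (auto simp: frac_lt_1)

lemma radix_digit_eq:
  assumes "t \<in> {0..<1}"
  shows "real (radix_digit m t n) = real (m n) * radix_rem m t n - radix_rem m t (Suc n)"
  using radix_rem_bounds[OF assms, of m n] by (simp add: radix_digit_def frac_def)

lemma radix_digit_less:
  assumes "t \<in> {0..<1}" "m n > 0"
  shows "radix_digit m t n < m n"
proof -
  have "real (m n) * radix_rem m t n < real (m n) * 1"
    using radix_rem_bounds[OF assms(1), of m n] assms(2) by (intro mult_strict_left_mono) auto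
  then have "real (radix_digit m t n) < real (m n)"
    using radix_digit_eq[OF assms(1), of m n] radix_rem_bounds[OF assms(1), of m "Suc n"]
    by (auto simp del: radix_rem.simps)
  then show ?thesis by simp
qed

text \<open>Since the next remainder is \<open>m n\<close> times the current one minus the digit,
  equal digits cancel and the difference is only scaled.\<close>

lemma radix_prefix_diff:
  assumes "t \<in> {0..<1}" "u \<in> {0..<1}" "\<And>k. k < n \<Longrightarrow> radix_digit m t k = radix_digit m u k"
  shows "(t - u) * (\<Prod>k<n. real (m k)) = radix_rem m t n - radix_rem m u n"
  using assms(3)
proof (induction n)
  case (Suc n)
  have "real (m n) * radix_rem m t n - radix_rem m t (Suc n)
      = real (m n) * radix_rem m u n - radix_rem m u (Suc n)"
    using radix_digit_eq[OF assms(1), of m n] radix_digit_eq[OF assms(2), of m n] Suc.prems[of n] by simp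
  moreover have "(t - u) * (\<Prod>k<Suc n. real (m k)) = (radix_rem m t n - radix_rem m u n) * m n"
    using Suc by (simp flip: mult.assoc)
  ultimately show ?case by (simp add: algebra_simps)
qed simp

text \<open>A differing digit exists, since equality of the first n digits forces the distance to be
  at most 2^(-n). At the first one, the remainders add at most 1 to the digit difference, hence the
  factor 2. The digit difference is kept in the bound: replacing it by \<open>m n\<close> would be
  too coarse for the Hoelder estimate.\<close>

lemma radix_first_diff:
  assumes "t \<in> {0..<1}" "u \<in> {0..<1}" "t \<noteq> u" and m: "\<And>k. m k \<ge> 2"
  obtains n where "\<And>k. k < n \<Longrightarrow> radix_digit m t k = radix_digit m u k"
    "radix_digit m t n \<noteq> radix_digit m u n"
    "\<bar>t - u\<bar> \<le> 2 * \<bar>real (radix_digit m t n) - real (radix_digit m u n)\<bar> / (\<Prod>k<Suc n. real (m k))"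
proof -
  have prod_pos: "(\<Prod>k<n. real (m k)) > 0" for n
    by (intro prod_pos) (use m in \<open>auto intro: less_le_trans[of 0 "2::nat"]\<close>)
  have "\<exists>n. radix_digit m t n \<noteq> radix_digit m u n"
  proof (rule ccontr)
    assume "\<not> ?thesis"
    then have *: "(t - u) * (\<Prod>k<n. real (m k)) = radix_rem m t n - radix_rem m u n" for n
      by (intro radix_prefix_diff assms) auto
    have le: "\<bar>t - u\<bar> * 2 ^ n \<le> 1" for n
    proof -
      have "(\<Prod>k<n. 2) \<le> (\<Prod>k<n. real (m k))"
        by (intro prod_mono) (use m in \<open>auto simp: numeral_le_real_of_nat_iff\<close>)
      then have "\<bar>t - u\<bar> * 2 ^ n \<le> \<bar>t - u\<bar> * (\<Prod>k<n. real (m k))"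
        by (intro mult_left_mono) auto
      also have "\<dots> = \<bar>radix_rem m t n - radix_rem m u n\<bar>"
        using *[of n] prod_pos[of n] by (metis abs_mult abs_of_pos)
      also have "\<dots> \<le> 1"
        using radix_rem_bounds[OF assms(1), of m n] radix_rem_bounds[OF assms(2), of m n] by auto
      finally show ?thesis .
    qed
    obtain n where "1 / \<bar>t - u\<bar> < 2 ^ n"
      using real_arch_pow[of 2 "1 / \<bar>t - u\<bar>"] by auto
    then show False using le[of n] \<open>t \<noteq> u\<close> by (simp add: field_simps)
  qed
  then obtain n where n: "radix_digit m t n \<noteq> radix_digit m u n"
    "\<And>k. k < n \<Longrightarrow> radix_digit m t k = radix_digit m u k"
    using exists_least_iff[of "\<lambda>n. radix_digit m t n \<noteq> radix_digit m u n"] by metis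
  define D where "D = \<bar>real (radix_digit m t n) - real (radix_digit m u n)\<bar>"
  have "D \<ge> 1" using n(1) unfolding D_def by linarith
  have "\<bar>t - u\<bar> * (\<Prod>k<Suc n. real (m k)) = \<bar>radix_rem m t n - radix_rem m u n\<bar> * real (m n)"
    using radix_prefix_diff[OF assms(1,2) n(2)] prod_pos[of n]
    by (simp flip: mult.assoc) (metis abs_mult abs_of_pos)
  also have "\<dots> = \<bar>real (m n) * radix_rem m t n - real (m n) * radix_rem m u n\<bar>"
    by (simp add: abs_mult right_diff_distrib[symmetric] mult.commute)
  also have "\<dots> \<le> D + 1"
    using radix_digit_eq[OF assms(1), of m n] radix_digit_eq[OF assms(2), of m n]
      radix_rem_bounds[OF assms(1), of m "Suc n"] radix_rem_bounds[OF assms(2), of m "Suc n"]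
    unfolding D_def by (auto simp del: radix_rem.simps)
  also have "\<dots> \<le> 2 * D" using \<open>D \<ge> 1\<close> by simp
  finally have "\<bar>t - u\<bar> \<le> 2 * D / (\<Prod>k<Suc n. real (m k))"
    using prod_pos[of "Suc n"] by (simp add: pos_le_divide_eq del: prod.lessThan_Suc)
  with n show ?thesis unfolding D_def by (intro that[of n])
qed


section \<open>Points with regularly growing partial quotients\<close>

text \<open>The range starts at 1 because psi 0 is unconstrained in the theorem. Growth by at most
  \<beta> controls the Hoelder exponent; superlinearity absorbs all factors C^n.\<close>

definition regular_growth :: "real \<Rightarrow> (nat \<Rightarrow> real) \<Rightarrow> bool" where
  "regular_growth \<beta> \<theta> \<longleftrightarrow>
    (\<forall>n\<ge>1. 0 < \<theta> n \<and> \<theta> n \<le> \<theta> (Suc n) \<and> \<theta> (Suc n) \<le> \<beta> * \<theta> n) \<and>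
    filterlim (\<lambda>n. \<theta> n / real n) at_top sequentially"

text \<open>If digits first differ at index n, by D, then up to factors C^n the distance in t is at
  most D exp (- theta(n+1)) and the distance in x at least D exp (- 2 theta(n+1)). The worst case is
  D of size exp (theta(n+1) - theta(n)), where exponent s is possible if s theta(n+1) - (1 - s)
  theta(n) stays negative enough.\<close>

lemma hausdorff_measure_neq_0_regular:
  assumes "regular_growth \<beta> \<theta>" "\<beta> > 0" "0 \<le> s" "s < 1 / (\<beta> + 1)"
  shows "hausdorff_measure s {x \<in> unit_irrationals. (\<lambda>n. log_quotient_sum n x / \<theta> n) \<longlonglongrightarrow> 1} \<noteq> 0"
proof -
  have pos: "0 < \<theta> n" and mono: "\<theta> n \<le> \<theta> (Suc n)" and growth: "\<theta> (Suc n) \<le> \<beta> * \<theta> n"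
    if "n \<ge> 1" for n
    using assms(1) that by (auto simp: regular_growth_def)
  have lim: "filterlim (\<lambda>n. \<theta> n / real n) at_top sequentially"
    using assms(1) by (simp add: regular_growth_def)
  \<comment> \<open>The value 0 at index 0 makes the increments \<open>d\<close> telescope to
    \<open>\<phi> n\<close>.\<close>
  define \<phi> where "\<phi> n = (if n = 0 then 0 else \<theta> n)" for n
  have \<phi>0: "\<phi> 0 = 0" and \<phi>\<theta>: "\<And>n. n \<ge> 1 \<Longrightarrow> \<phi> n = \<theta> n" by (auto simp: \<phi>_def)
  define d where "d k = \<phi> (Suc k) - \<phi> k" for k
  have d0: "d k \<ge> 0" for k
    using pos[of "Suc k"] mono[of k] by (auto simp: d_def \<phi>_def)
  \<comment> \<open>The added 1 makes \<open>m k\<close> at least exp (d k), and at least 2 even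
    where theta is constant.\<close>
  define m where "m k = nat \<lfloor>exp (d k)\<rfloor> + 1" for k
  have m1: "exp (d k) \<le> m k" and m2: "m k \<le> 2 * exp (d k)" and m_ge: "m k \<ge> 2" for k
  proof -
    have 1: "exp (d k) \<ge> 1" using d0 by simp
    then have eq: "real (m k) = of_int \<lfloor>exp (d k)\<rfloor> + 1"
      by (simp add: m_def)
    show "exp (d k) \<le> m k" unfolding eq by linarith
    show "m k \<le> 2 * exp (d k)" unfolding eq using 1 of_int_floor_le[of "exp (d k)"] by linarith
    have "\<lfloor>exp (d k)\<rfloor> \<ge> 1" using 1 by (simp add: le_floor_iff)
    then show "m k \<ge> 2" unfolding m_def by linarith
  qed
  have m_pos: "m k > 0" for k using m_ge[of k] by simp
  have prod_ge: "exp (\<phi> n) \<le> (\<Prod>k<n. real (m k))" for n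
  proof (induction n)
    case (Suc n)
    have "exp (\<phi> (Suc n)) = exp (\<phi> n) * exp (d n)" by (simp add: d_def exp_add[symmetric])
    also have "\<dots> \<le> (\<Prod>k<n. real (m k)) * m n" using Suc m1[of n] by (intro mult_mono) (auto intro: prod_nonneg)
    finally show ?case by simp
  qed (simp add: \<phi>0)
  \<comment> \<open>The base 16 arises from 2 m \<le> 4 exp d, squared.\<close>
  have prod_le: "(\<Prod>k<n. (2 * real (m k))\<^sup>2) \<le> 16 ^ n * exp (2 * \<phi> n)" for n
  proof (induction n)
    case (Suc n)
    have "(2 * real (m n))\<^sup>2 \<le> (4 * exp (d n))\<^sup>2" using m2[of n] by (intro power_mono) auto
    also have "\<dots> = 16 * exp (2 * d n)" by (simp add: power_mult_distrib exp_double)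
    finally have "(\<Prod>k<n. (2 * real (m k))\<^sup>2) * (2 * real (m n))\<^sup>2 \<le> (16 ^ n * exp (2 * \<phi> n)) * (16 * exp (2 * d n))"
      using Suc by (intro mult_mono) auto
    also have "\<dots> = 16 ^ Suc n * (exp (2 * \<phi> n) * exp (2 * d n))" by simp
    also have "exp (2 * \<phi> n) * exp (2 * d n) = exp (2 * \<phi> (Suc n))"
      by (simp add: d_def exp_add[symmetric] algebra_simps)
    finally show ?case by simp
  qed (simp add: \<phi>0)
  \<comment> \<open>Shifting the digit by \<open>m k\<close> puts the quotient into [m k, 2 m k):
    every digit is admissible, yet each logarithm is within ln 4 of \<open>d k\<close>.\<close>
  define a where "a t k = m k + radix_digit m t k" for t k
  have a_ge: "a t k \<ge> 2" for t k using m_ge[of k] by (simp add: a_def)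
  have a_le: "real (a t k) + 1 \<le> 2 * real (m k)" if "t \<in> {0..<1}" for t k
    using radix_digit_less[of t m k, OF that m_pos] by (simp add: a_def)
  \<comment> \<open>The logarithm of the worst-case ratio between the distance in t and the s-th
    power of the distance in x; the last term comes from 16^(n+1).\<close>
  define E where "E n = s * \<phi> (Suc n) - (1 - s) * \<phi> n + s * (real (Suc n) * ln 16)" for n
  obtain K where K: "\<And>n. E n \<le> K"
  proof -
    \<comment> \<open>Positivity of \<open>\<gamma>\<close> is the hypothesis s < 1/(\<beta> + 1).
      Eventually E n \<le> 2 s n ln 16 - \<gamma> theta(n), which superlinearity makes
      nonpositive.\<close>
    define \<gamma> where "\<gamma> = 1 - s - s * \<beta>"
    have "\<gamma> > 0" using assms(2-4) by (simp add: \<gamma>_def field_simps)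
    have "\<forall>\<^sub>F n in sequentially. 2 * s * ln 16 / \<gamma> \<le> \<theta> n / real n"
      using lim unfolding filterlim_at_top by blast
    then have "\<forall>\<^sub>F n in sequentially. E n \<le> 0"
      using eventually_ge_at_top[of 1]
    proof eventually_elim
      case (elim n)
      have "2 * s * ln 16 * real n \<le> \<gamma> * \<theta> n"
        using elim \<open>\<gamma> > 0\<close> by (simp add: field_simps)
      moreover have "s * \<theta> (Suc n) \<le> s * (\<beta> * \<theta> n)"
        using growth[of n] elim \<open>0 \<le> s\<close> by (intro mult_left_mono) auto
      moreover have "s * ln 16 * real (Suc n) \<le> s * ln 16 * (2 * real n)"
        using elim \<open>0 \<le> s\<close> by (intro mult_left_mono) auto
      ultimately show ?case
        using elim \<phi>\<theta>[of n] \<phi>\<theta>[of "Suc n"] by (simp add: E_def \<gamma>_def algebra_simps)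
    qed
    then obtain N where N: "\<And>n. n \<ge> N \<Longrightarrow> E n \<le> 0" by (auto simp: eventually_sequentially)
    have "E n \<le> Max (insert 0 (E ` {..<N}))" for n
      using N[of n] by (cases "n < N") (auto simp: Max_ge_iff)
    then show ?thesis by (rule that)
  qed
  show ?thesis
  proof (rule hausdorff_measure_neq_0I[where g = "\<lambda>t. cf_value (a t)" and C = "4 * exp K"])
    fix t :: real assume t: "t \<in> {0..<1}"
    have S_bounds: "\<phi> n \<le> log_quotient_sum n (cf_value (a t)) \<and>
        log_quotient_sum n (cf_value (a t)) \<le> \<phi> n + real n * ln 4" for n
    proof (induction n)
      case (Suc n)
      have "exp (d n) \<le> real (a t n)" using m1[of n] by (simp add: a_def)
      moreover have "real (a t n) \<le> 4 * exp (d n)" using a_le[OF t, of n] m2[of n] by linarith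
      moreover have "real (a t n) > 0" using a_ge[of t n] by simp
      ultimately have "ln (exp (d n)) \<le> ln (real (a t n))" "ln (real (a t n)) \<le> ln (4 * exp (d n))"
        by (simp_all only: ln_le_cancel_iff exp_gt_zero mult_pos_pos zero_less_numeral)
      then have "d n \<le> ln (real (a t n))" "ln (real (a t n)) \<le> ln 4 + d n"
        by (simp_all add: ln_mult)
      then show ?case
        using Suc partial_quotient_cf_value[of "a t" n, OF a_ge]
        by (simp add: log_quotient_sum_Suc d_def algebra_simps)
    qed (simp add: \<phi>0)
    have "(\<lambda>n. log_quotient_sum n (cf_value (a t)) / \<theta> n) \<longlonglongrightarrow> 1"
    proof (rule tendsto_sandwich[where f = "\<lambda>_. 1"])
      have "(\<lambda>n. inverse (\<theta> n / real n)) \<longlonglongrightarrow> 0"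
        using lim tendsto_inverse_0_at_top by blast
      then have "(\<lambda>n. 1 + ln 4 * inverse (\<theta> n / real n)) \<longlonglongrightarrow> 1 + ln 4 * 0"
        by (intro tendsto_intros)
      then show "(\<lambda>n. 1 + ln 4 * inverse (\<theta> n / real n)) \<longlonglongrightarrow> 1" by simp
      show "\<forall>\<^sub>F n in sequentially. log_quotient_sum n (cf_value (a t)) / \<theta> n \<le> 1 + ln 4 * inverse (\<theta> n / real n)"
        using eventually_ge_at_top[of 1]
      proof eventually_elim
        case (elim n)
        then show ?case using S_bounds[of n] pos[of n] \<phi>\<theta>[of n] by (simp add: field_simps)
      qed
      show "\<forall>\<^sub>F n in sequentially. 1 \<le> log_quotient_sum n (cf_value (a t)) / \<theta> n"
        using eventually_ge_at_top[of 1]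
      proof eventually_elim
        case (elim n)
        then show ?case using S_bounds[of n] pos[of n] \<phi>\<theta>[of n] by simp
      qed
    qed auto
    then show "cf_value (a t) \<in> {x \<in> unit_irrationals. (\<lambda>n. log_quotient_sum n x / \<theta> n) \<longlonglongrightarrow> 1}"
      using cf_value_in_unit_irrationals[of "a t", OF a_ge] by simp
  next
    fix t u :: real assume t: "t \<in> {0..<1}" and u: "u \<in> {0..<1}" and "t \<noteq> u"
    obtain n where n: "\<And>k. k < n \<Longrightarrow> radix_digit m t k = radix_digit m u k"
      "radix_digit m t n \<noteq> radix_digit m u n"
      "\<bar>t - u\<bar> \<le> 2 * \<bar>real (radix_digit m t n) - real (radix_digit m u n)\<bar> / (\<Prod>k<Suc n. real (m k))"
      using radix_first_diff[of t u m, OF t u \<open>t \<noteq> u\<close> m_ge] by blast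
    define D where "D = \<bar>real (radix_digit m t n) - real (radix_digit m u n)\<bar>"
    have "D > 0" using n(2) by (simp add: D_def)
    have "D \<le> m n"
      using radix_digit_less[of t m n, OF t m_pos] radix_digit_less[of u m n, OF u m_pos] by (simp add: D_def)
    then have "ln D \<le> ln (2 * exp (d n))"
      using m2[of n] \<open>D > 0\<close> by simp
    then have lnD: "ln D \<le> ln 2 + d n" by (simp add: ln_mult)
    have "s < 1"
    proof -
      have "1 / (\<beta> + 1) \<le> 1" using \<open>\<beta> > 0\<close> by simp
      then show ?thesis using assms(4) by linarith
    qed
    \<comment> \<open>Of the factor D in the distance of t, the power D^s is matched by
      \<open>\<delta> powr s\<close>; only D^(1-s) has to be estimated by the number of digits. The
      4 in the Hoelder constant collects the 2 from the digit estimate and the 2 from D \<le> 2 exp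
      (d n).\<close>
    then have lnD': "(1 - s) * ln D \<le> (1 - s) * (ln 2 + d n)"
      using lnD by (intro mult_left_mono) auto
    define \<delta> where "\<delta> = D / 2 / (16 ^ Suc n * exp (2 * \<phi> (Suc n)))"
    have "\<delta> > 0" using \<open>D > 0\<close> by (simp add: \<delta>_def)
    have "\<delta> \<le> D / 2 / (\<Prod>k\<le>n. (2 * real (m k))\<^sup>2)"
      unfolding \<delta>_def using prod_le[of "Suc n"] \<open>D > 0\<close> m_pos
      by (intro divide_left_mono) (auto simp: lessThan_Suc_atMost intro!: mult_pos_pos prod_pos)
    also have "\<dots> = \<bar>real (a t n) - real (a u n)\<bar> / 2 / (\<Prod>k\<le>n. (2 * real (m k))\<^sup>2)"
      by (simp add: a_def D_def)
    also have "\<dots> \<le> \<bar>cf_value (a t) - cf_value (a u)\<bar>"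
    proof (rule cf_value_separation)
      show "a t k = a u k" if "k < n" for k using n(1)[OF that] by (simp add: a_def)
      show "a t n \<noteq> a u n" using n(2) by (simp add: a_def)
    qed (intro a_ge a_le t u)+
    finally have "\<delta> powr s \<le> dist (cf_value (a t)) (cf_value (a u)) powr s"
      using \<open>\<delta> > 0\<close> \<open>0 \<le> s\<close> by (intro powr_mono2) (auto simp: dist_real_def)
    then have dist: "4 * exp K * \<delta> powr s \<le> 4 * exp K * dist (cf_value (a t)) (cf_value (a u)) powr s"
      by (intro mult_left_mono) auto
    have "\<bar>t - u\<bar> \<le> 2 * D / (\<Prod>k<Suc n. real (m k))" using n(3) by (simp only: D_def)
    also have "\<dots> \<le> 2 * D / exp (\<phi> (Suc n))"
      using prod_ge[of "Suc n"] \<open>D > 0\<close> m_pos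
      by (intro divide_left_mono) (auto intro!: mult_pos_pos prod_pos)
    also have "\<dots> = exp (ln 2 + ln D - \<phi> (Suc n))"
      using \<open>D > 0\<close> by (simp add: exp_add exp_diff)
    also have "\<dots> \<le> exp (2 * ln 2 + K + s * (ln D - ln 2 - real (Suc n) * ln 16 - 2 * \<phi> (Suc n)))"
      using lnD' K[of n] by (simp add: E_def d_def algebra_simps)
    also have "\<dots> = 4 * exp K * \<delta> powr s"
    proof -
      have "ln \<delta> = ln D - ln 2 - real (Suc n) * ln 16 - 2 * \<phi> (Suc n)"
        unfolding \<delta>_def using \<open>D > 0\<close> by (simp add: ln_div ln_mult ln_realpow del: power_Suc of_nat_Suc)
      then have "\<delta> powr s = exp (s * (ln D - ln 2 - real (Suc n) * ln 16 - 2 * \<phi> (Suc n)))"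
        using \<open>\<delta> > 0\<close> by (simp add: powr_def)
      moreover have "exp (2 * ln 2) = (4::real)" by (simp add: exp_double)
      ultimately show ?thesis by (simp only: exp_add)
    qed
    finally show "\<bar>t - u\<bar> \<le> 4 * exp K * dist (cf_value (a t)) (cf_value (a u)) powr s"
      using dist by linarith
  qed (use \<open>0 \<le> s\<close> in auto)
qed

lemma attains_min_at_top:
  fixes f :: "nat \<Rightarrow> real"
  assumes "filterlim f at_top sequentially"
  shows "\<exists>k\<ge>1. \<forall>j\<ge>1. f k \<le> f j"
proof -
  have "\<forall>\<^sub>F j in sequentially. f 1 \<le> f j" using assms unfolding filterlim_at_top by blast
  then obtain N where N: "\<And>j. j \<ge> N \<Longrightarrow> f 1 \<le> f j" by (auto simp: eventually_sequentially)
  define k where "k = arg_min_on f {1..max 1 N}"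
  have k: "k \<in> {1..max 1 N}" "\<And>j. j \<in> {1..max 1 N} \<Longrightarrow> f k \<le> f j"
    unfolding k_def by (auto intro!: arg_min_if_finite(1) arg_min_least simp del: atLeastAtMost_iff)
  have "f k \<le> f j" if "j \<ge> 1" for j
  proof (cases "j \<le> max 1 N")
    case False
    then have "f 1 \<le> f j" using N[of j] by simp
    moreover have "f k \<le> f 1" using k(2)[of 1] by simp
    ultimately show ?thesis by simp
  qed (use k(2)[of j] that in auto)
  with k show ?thesis by auto
qed


section \<open>Regular envelopes\<close>

text \<open>Truncated subtraction is intended in the exponents of \<open>f\<close> in the next two proofs. If \<open>\<kappa> n\<close> is an
  optimal index for \<open>n\<close> and \<open>n \<le> \<kappa> n\<close>, then \<open>\<theta>\<close> and \<open>\<psi>\<close> agree at \<open>\<kappa> n\<close>; the record values of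
  \<open>\<psi> n / \<beta> ^ n\<close> (minorant) and of \<open>\<psi> n\<close> (majorant) supply such \<open>n\<close>.\<close>

lemma regular_minorant:
  fixes \<psi> :: "nat \<Rightarrow> real"
  assumes pos: "\<And>n. n \<ge> 1 \<Longrightarrow> \<psi> n > 0"
    and lim: "filterlim (\<lambda>n. \<psi> n / real n) at_top sequentially"
    and "\<beta> > 1" and small: "\<And>\<epsilon>. \<epsilon> > 0 \<Longrightarrow> \<exists>n\<ge>1. \<psi> n < \<epsilon> * \<beta> ^ n"
  obtains \<theta> :: "nat \<Rightarrow> real"
  where "regular_growth \<beta> \<theta>" "\<forall>n\<ge>1. \<theta> n \<le> \<psi> n" "\<exists>\<^sub>F n in sequentially. \<theta> n = \<psi> n"
proof -
  \<comment> \<open>Each psi k limits a regular minorant: to the left of k by monotonicity, to the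
    right by the growth factor. The minimum over k is therefore the largest candidate.\<close>
  define f where "f n k = \<psi> k * \<beta> ^ (n - k)" for n k
  have lim\<psi>: "filterlim \<psi> at_top sequentially"
  proof (rule filterlim_at_top_mono[OF lim])
    show "\<forall>\<^sub>F n in sequentially. \<psi> n / real n \<le> \<psi> n"
      using eventually_ge_at_top[of 1]
    proof eventually_elim
      case (elim n)
      then show ?case using pos[of n] mult_left_mono[of 1 "real n" "\<psi> n"] by (simp add: field_simps)
    qed
  qed
  have lim_f: "filterlim (f n) at_top sequentially" for n
  proof (rule filterlim_at_top_mono[OF lim\<psi>])
    show "\<forall>\<^sub>F k in sequentially. \<psi> k \<le> f n k"
      using eventually_ge_at_top[of n] by eventually_elim (simp add: f_def)
  qed
  have "\<exists>\<kappa>. \<forall>n. \<kappa> n \<ge> 1 \<and> (\<forall>j\<ge>1. f n (\<kappa> n) \<le> f n j)"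
    by (rule choice) (use attains_min_at_top[OF lim_f] in blast)
  then obtain \<kappa> where \<kappa>: "\<And>n. \<kappa> n \<ge> 1" "\<And>n j. j \<ge> 1 \<Longrightarrow> f n (\<kappa> n) \<le> f n j"
    by blast
  define \<theta> where "\<theta> n = f n (\<kappa> n)" for n
  obtain m where m: "m > 0" "\<And>k. k \<ge> 1 \<Longrightarrow> m \<le> \<psi> k"
    using attains_min_at_top[OF lim\<psi>] pos by metis
  have \<theta>_pos: "0 < \<theta> n" for n
    using pos[OF \<kappa>(1)] \<open>\<beta> > 1\<close> by (simp add: \<theta>_def f_def)
  have \<theta>_mono: "\<theta> n \<le> \<theta> (Suc n)" for n
  proof -
    have "\<theta> n \<le> f n (\<kappa> (Suc n))" unfolding \<theta>_def by (intro \<kappa>)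
    also have "\<dots> \<le> \<theta> (Suc n)"
      using pos[OF \<kappa>(1)[of "Suc n"]] \<open>\<beta> > 1\<close>
      unfolding \<theta>_def f_def by (intro mult_left_mono power_increasing) auto
    finally show ?thesis .
  qed
  have \<theta>_growth: "\<theta> (Suc n) \<le> \<beta> * \<theta> n" for n
  proof -
    have "\<theta> (Suc n) \<le> f (Suc n) (\<kappa> n)" unfolding \<theta>_def by (intro \<kappa>)
    also have "\<dots> \<le> \<psi> (\<kappa> n) * \<beta> ^ Suc (n - \<kappa> n)"
      using pos[OF \<kappa>(1)[of n]] \<open>\<beta> > 1\<close>
      unfolding f_def by (intro mult_left_mono power_increasing) auto
    also have "\<dots> = \<beta> * \<theta> n" by (simp add: \<theta>_def f_def)
    finally show ?thesis .
  qed
  have \<theta>_le: "\<theta> n \<le> \<psi> n" if "n \<ge> 1" for n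
    using \<kappa>(2)[OF that, of n] by (simp add: \<theta>_def f_def)
  have "\<exists>n\<ge>N. \<theta> n = \<psi> n" for N
  proof -
    \<comment> \<open>As psi is at least \<open>m\<close>, the ratio psi n / \<beta>^n cannot fall
      below this threshold for n \<le> N.\<close>
    define \<epsilon> where "\<epsilon> = m / \<beta> ^ N"
    have "\<epsilon> > 0" using m \<open>\<beta> > 1\<close> by (simp add: \<epsilon>_def)
    define P where "P n \<longleftrightarrow> n \<ge> 1 \<and> \<psi> n < \<epsilon> * \<beta> ^ n" for n
    have exP: "\<exists>n. P n" using small[OF \<open>\<epsilon> > 0\<close>] unfolding P_def .
    \<comment> \<open>At the first fall below the threshold, any earlier k has psi k \<beta>^(n-k)
      \<ge> \<epsilon> \<beta>^n > psi n, so no earlier index is optimal for n.\<close>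
    define n where "n = (LEAST n. P n)"
    have "P n" unfolding n_def using exP by (rule LeastI_ex)
    then have n: "n \<ge> 1" "\<psi> n < \<epsilon> * \<beta> ^ n" by (auto simp: P_def)
    have least: "\<epsilon> * \<beta> ^ k \<le> \<psi> k" if "k \<ge> 1" "k < n" for k
      using not_less_Least[of k P] that by (auto simp: P_def n_def)
    have "N \<le> n"
    proof (rule ccontr)
      assume "\<not> N \<le> n"
      then have "\<epsilon> * \<beta> ^ n \<le> \<epsilon> * \<beta> ^ N"
        using \<open>\<epsilon> > 0\<close> \<open>\<beta> > 1\<close> by (intro mult_left_mono power_increasing) auto
      also have "\<dots> = m" using \<open>\<beta> > 1\<close> by (simp add: \<epsilon>_def)
      finally show False using n m(2)[of n] by simp
    qed
    have ge: "n \<le> \<kappa> n"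
    proof (rule ccontr)
      assume lt: "\<not> n \<le> \<kappa> n"
      have "\<psi> n < \<epsilon> * \<beta> ^ \<kappa> n * \<beta> ^ (n - \<kappa> n)"
        using n lt by (simp add: mult.assoc flip: power_add)
      also have "\<dots> \<le> \<psi> (\<kappa> n) * \<beta> ^ (n - \<kappa> n)"
        using least[of "\<kappa> n"] \<kappa>(1) lt \<open>\<beta> > 1\<close> by (intro mult_right_mono) auto
      also have "\<dots> = \<theta> n" by (simp add: \<theta>_def f_def)
      finally show False using \<theta>_le[OF n(1)] by simp
    qed
    have "\<theta> (\<kappa> n) \<le> \<psi> (\<kappa> n)" by (intro \<theta>_le \<kappa>)
    also have "\<dots> = \<theta> n" using ge by (simp add: \<theta>_def f_def)
    finally have "\<theta> (\<kappa> n) \<le> \<theta> n" .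
    moreover have "\<theta> n \<le> \<theta> (\<kappa> n)" using ge \<theta>_mono by (rule lift_Suc_mono_le[rotated])
    moreover have "\<theta> n = \<psi> (\<kappa> n)" using ge by (simp add: \<theta>_def f_def)
    ultimately show ?thesis using ge \<open>N \<le> n\<close> by (intro exI[of _ "\<kappa> n"]) auto
  qed
  then have touch: "\<exists>\<^sub>F n in sequentially. \<theta> n = \<psi> n"
    unfolding frequently_sequentially by blast
  have "filterlim (\<lambda>n. \<theta> n / real n) at_top sequentially"
    unfolding filterlim_at_top_ge[where c = 0]
  proof (intro allI impI)
    fix M :: real assume "0 \<le> M"
    have "filterlim (\<lambda>j. \<beta> ^ j / (1 + real j)) at_top sequentially" using \<open>\<beta> > 1\<close> by real_asymp
    from attains_min_at_top[OF this] obtain k where k: "\<And>j. j \<ge> 1 \<Longrightarrow> \<beta> ^ k / (1 + real k) \<le> \<beta> ^ j / (1 + real j)"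
      by blast
    \<comment> \<open>A positive constant with C (1 + j) \<le> \<beta>^j for all j; the entry 1
      covers j = 0.\<close>
    define C where "C = min 1 (\<beta> ^ k / (1 + real k))"
    have "C > 0" using \<open>\<beta> > 1\<close> by (simp add: C_def)
    have C: "C * (1 + real j) \<le> \<beta> ^ j" for j
    proof (cases "j = 0")
      case False
      then have "C \<le> \<beta> ^ j / (1 + real j)" using k[of j] by (simp add: C_def)
      then show ?thesis by (simp add: field_simps)
    qed (simp add: C_def)
    obtain L where L: "\<And>k. k \<ge> L \<Longrightarrow> M / C \<le> \<psi> k / real k"
      using lim unfolding filterlim_at_top eventually_sequentially by metis
    have "filterlim (\<lambda>n. m / \<beta> ^ L * \<beta> ^ n / real n) at_top sequentially"
      using m \<open>\<beta> > 1\<close> by real_asymp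
    then have "\<forall>\<^sub>F n in sequentially. M \<le> m / \<beta> ^ L * \<beta> ^ n / real n"
      unfolding filterlim_at_top by blast
    then show "\<forall>\<^sub>F n in sequentially. M \<le> \<theta> n / real n"
      using eventually_ge_at_top[of "max 1 L"]
    proof eventually_elim
      case (elim n)
      show ?case
      \<comment> \<open>An optimal index below \<open>L\<close> leaves an exponential factor
        \<beta>^(n-L). A later one has psi k \<ge> (M/C) k for k = \<open>\<kappa> n\<close>, and n
        \<le> k (1 + (n - k)) turns this into the bound M n.\<close>
      proof (cases "\<kappa> n < L")
        case True
        have "m / \<beta> ^ L * \<beta> ^ n = m * \<beta> ^ (n - L)"
          using elim \<open>\<beta> > 1\<close> by (simp add: power_diff)
        also have "\<dots> \<le> \<theta> n"
          unfolding \<theta>_def f_def using m(1) m(2)[OF \<kappa>(1)[of n]] True \<open>\<beta> > 1\<close>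
          by (intro mult_mono power_increasing) auto
        finally have "m / \<beta> ^ L * \<beta> ^ n / real n \<le> \<theta> n / real n"
          by (intro divide_right_mono) auto
        then show ?thesis using elim by linarith
      next
        case False
        have "real n \<le> real (\<kappa> n) * (1 + real (n - \<kappa> n))"
        proof (cases "\<kappa> n \<le> n")
          case True
          have "1 * real (n - \<kappa> n) \<le> real (\<kappa> n) * real (n - \<kappa> n)"
            using \<kappa>(1)[of n] by (intro mult_right_mono) auto
          then show ?thesis using True by (simp add: algebra_simps of_nat_diff)
        qed simp
        then have "M * real n \<le> M * (real (\<kappa> n) * (1 + real (n - \<kappa> n)))"
          using \<open>0 \<le> M\<close> by (intro mult_left_mono) auto
        also have "\<dots> = (M / C * real (\<kappa> n)) * (C * (1 + real (n - \<kappa> n)))"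
          using \<open>C > 0\<close> by simp
        also have "\<dots> \<le> \<psi> (\<kappa> n) * \<beta> ^ (n - \<kappa> n)"
        proof (intro mult_mono C)
          show "M / C * real (\<kappa> n) \<le> \<psi> (\<kappa> n)"
            using L[of "\<kappa> n"] False \<kappa>(1)[of n] by (simp add: pos_le_divide_eq)
        qed (use pos[OF \<kappa>(1)[of n]] \<open>C > 0\<close> in auto)
        also have "\<dots> = \<theta> n" by (simp add: \<theta>_def f_def)
        finally show ?thesis using elim by (simp add: pos_le_divide_eq)
      qed
    qed
  qed
  then have "regular_growth \<beta> \<theta>"
    using \<theta>_pos \<theta>_mono \<theta>_growth by (simp add: regular_growth_def)
  then show ?thesis using that \<theta>_le touch by blast
qed

lemma regular_majorant:
  fixes \<psi> :: "nat \<Rightarrow> real"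
  assumes pos: "\<And>n. n \<ge> 1 \<Longrightarrow> \<psi> n > 0"
    and lim: "filterlim (\<lambda>n. \<psi> n / real n) at_top sequentially"
    and "\<beta> > 1" and small: "filterlim (\<lambda>n. \<beta> ^ n / \<psi> n) at_top sequentially"
  obtains \<theta> :: "nat \<Rightarrow> real"
  where "regular_growth \<beta> \<theta>" "\<forall>n\<ge>1. \<psi> n \<le> \<theta> n" "\<exists>\<^sub>F n in sequentially. \<theta> n = \<psi> n"
proof -
  \<comment> \<open>Reciprocals are used so that the maximum defining the majorant becomes a
    minimum.\<close>
  define f where "f n k = \<beta> ^ (k - n) / \<psi> k" for n k
  have lim_f: "filterlim (f n) at_top sequentially" for n
  proof -
    have "filterlim (\<lambda>k. (1 / \<beta> ^ n) * (\<beta> ^ k / \<psi> k)) at_top sequentially"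
      using \<open>\<beta> > 1\<close> by (intro filterlim_tendsto_pos_mult_at_top[OF tendsto_const _ small]) auto
    moreover have "\<forall>\<^sub>F k in sequentially. (1 / \<beta> ^ n) * (\<beta> ^ k / \<psi> k) \<le> f n k"
      using eventually_ge_at_top[of n]
      by eventually_elim (use \<open>\<beta> > 1\<close> in \<open>simp add: f_def power_diff\<close>)
    ultimately show ?thesis by (rule filterlim_at_top_mono)
  qed
  have "\<exists>\<kappa>. \<forall>n. \<kappa> n \<ge> 1 \<and> (\<forall>j\<ge>1. f n (\<kappa> n) \<le> f n j)"
    by (rule choice) (use attains_min_at_top[OF lim_f] in blast)
  then obtain \<kappa> where \<kappa>: "\<And>n. \<kappa> n \<ge> 1" "\<And>n j. j \<ge> 1 \<Longrightarrow> f n (\<kappa> n) \<le> f n j"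
    by blast
  define \<theta> where "\<theta> n = 1 / f n (\<kappa> n)" for n
  have f_pos: "0 < f n k" if "k \<ge> 1" for n k
    using pos[OF that] \<open>\<beta> > 1\<close> by (simp add: f_def)
  have \<theta>_pos: "0 < \<theta> n" for n
    using f_pos[OF \<kappa>(1)] by (simp add: \<theta>_def)
  have \<theta>_ge_f: "1 / f n k \<le> \<theta> n" if "k \<ge> 1" for n k
    unfolding \<theta>_def using \<kappa>(2)[OF that] f_pos[OF that] f_pos[OF \<kappa>(1)]
    by (intro divide_left_mono) (auto intro!: mult_pos_pos)
  have \<theta>_mono: "\<theta> n \<le> \<theta> (Suc n)" for n
  proof -
    have "f (Suc n) (\<kappa> n) \<le> f n (\<kappa> n)"
      unfolding f_def using pos[OF \<kappa>(1)[of n]] \<open>\<beta> > 1\<close>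
      by (intro divide_right_mono power_increasing) auto
    then have "\<theta> n \<le> 1 / f (Suc n) (\<kappa> n)"
      unfolding \<theta>_def using f_pos[OF \<kappa>(1)] by (intro divide_left_mono) (auto intro!: mult_pos_pos)
    also have "\<dots> \<le> \<theta> (Suc n)" by (intro \<theta>_ge_f \<kappa>)
    finally show ?thesis .
  qed
  have \<theta>_growth: "\<theta> (Suc n) \<le> \<beta> * \<theta> n" for n
  proof -
    have "f n (\<kappa> (Suc n)) \<le> \<beta> ^ Suc (\<kappa> (Suc n) - Suc n) / \<psi> (\<kappa> (Suc n))"
      unfolding f_def using pos[OF \<kappa>(1)[of "Suc n"]] \<open>\<beta> > 1\<close>
      by (intro divide_right_mono power_increasing) auto
    also have "\<dots> = \<beta> * f (Suc n) (\<kappa> (Suc n))" by (simp add: f_def)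
    finally have "1 / (\<beta> * f (Suc n) (\<kappa> (Suc n))) \<le> 1 / f n (\<kappa> (Suc n))"
      using f_pos[OF \<kappa>(1)] \<open>\<beta> > 1\<close> by (intro divide_left_mono) (auto intro!: mult_pos_pos)
    then have "\<theta> (Suc n) / \<beta> \<le> 1 / f n (\<kappa> (Suc n))"
      by (simp add: \<theta>_def mult.commute)
    also have "\<dots> \<le> \<theta> n" by (intro \<theta>_ge_f \<kappa>)
    finally show ?thesis using \<open>\<beta> > 1\<close> by (simp add: field_simps)
  qed
  have \<theta>_ge: "\<psi> n \<le> \<theta> n" if "n \<ge> 1" for n
    using \<theta>_ge_f[OF that, of n] by (simp add: f_def)
  have "\<exists>n\<ge>N. \<theta> n = \<psi> n" for N
  proof -
    \<comment> \<open>The first n with psi n > \<open>Q\<close> lies beyond \<open>N\<close>, and an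
      earlier optimal index would give theta n \<le> Q < psi n.\<close>
    define Q where "Q = Max (insert 0 (\<psi> ` {..N}))"
    have Q: "\<psi> k \<le> Q" if "k \<le> N" for k unfolding Q_def using that by (intro Max_ge) auto
    define P where "P n \<longleftrightarrow> n \<ge> 1 \<and> Q < \<psi> n" for n
    have "\<forall>\<^sub>F n in sequentially. Q + 1 \<le> \<psi> n / real n"
      using lim unfolding filterlim_at_top by blast
    then have "\<forall>\<^sub>F n in sequentially. P n"
      using eventually_ge_at_top[of 1]
    proof eventually_elim
      case (elim n)
      have "0 \<le> Q" by (simp add: Q_def)
      have "(Q + 1) * 1 \<le> (Q + 1) * real n" using elim \<open>0 \<le> Q\<close> by (intro mult_left_mono) auto
      also have "\<dots> \<le> \<psi> n" using elim by (simp add: pos_le_divide_eq)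
      finally show ?case using elim by (simp add: P_def)
    qed
    then have exP: "\<exists>n. P n" by (auto simp: eventually_sequentially)
    define n where "n = (LEAST n. P n)"
    have "P n" unfolding n_def using exP by (rule LeastI_ex)
    then have n: "n \<ge> 1" "Q < \<psi> n" by (auto simp: P_def)
    have least: "\<psi> k \<le> Q" if "k \<ge> 1" "k < n" for k
      using not_less_Least[of k P] that by (auto simp: P_def n_def)
    have "N \<le> n" using n Q[of n] by (cases "N \<le> n") auto
    have ge: "n \<le> \<kappa> n"
    proof (rule ccontr)
      assume lt: "\<not> n \<le> \<kappa> n"
      then have "\<theta> n = \<psi> (\<kappa> n)" by (simp add: \<theta>_def f_def)
      also have "\<dots> < \<psi> n" using least[OF \<kappa>(1)[of n]] lt n by simp
      finally show False using \<theta>_ge[OF n(1)] by simp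
    qed
    \<comment> \<open>Growth from n to \<open>\<kappa> n\<close> is at most \<beta>^(\<kappa> n -
      n), which is exactly what lifts theta n to psi at the optimal index.\<close>
    have pow: "\<theta> (n + j) \<le> \<beta> ^ j * \<theta> n" for j
    proof (induction j)
      case (Suc j)
      have "\<theta> (n + Suc j) \<le> \<beta> * \<theta> (n + j)" using \<theta>_growth[of "n + j"] by simp
      also have "\<dots> \<le> \<beta> * (\<beta> ^ j * \<theta> n)" using Suc \<open>\<beta> > 1\<close> by (intro mult_left_mono) auto
      finally show ?case by simp
    qed simp
    have "\<theta> (\<kappa> n) \<le> \<beta> ^ (\<kappa> n - n) * \<theta> n" using pow[of "\<kappa> n - n"] ge by simp
    also have "\<dots> = \<psi> (\<kappa> n)" using \<open>\<beta> > 1\<close> by (simp add: \<theta>_def f_def)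
    finally have "\<theta> (\<kappa> n) = \<psi> (\<kappa> n)" using \<theta>_ge[OF \<kappa>(1)[of n]] by simp
    then show ?thesis using ge \<open>N \<le> n\<close> by (intro exI[of _ "\<kappa> n"]) auto
  qed
  then have touch: "\<exists>\<^sub>F n in sequentially. \<theta> n = \<psi> n"
    unfolding frequently_sequentially by blast
  have "filterlim (\<lambda>n. \<theta> n / real n) at_top sequentially"
  proof (rule filterlim_at_top_mono[OF lim])
    show "\<forall>\<^sub>F n in sequentially. \<psi> n / real n \<le> \<theta> n / real n"
      using eventually_ge_at_top[of 1]
      by eventually_elim (intro divide_right_mono \<theta>_ge, auto)
  qed
  then have "regular_growth \<beta> \<theta>"
    using \<theta>_pos \<theta>_mono \<theta>_growth by (simp add: regular_growth_def)
  then show ?thesis using that \<theta>_ge touch by blast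
qed


section \<open>The dimension formulas\<close>

lemma ln_ereal_less:
  assumes "0 < c" "ereal c < b"
  shows "ereal (ln c) < ln_ereal b"
  using assms by (cases b) (auto simp: ln_ereal_def)

lemma ln_ereal_greater:
  assumes "1 \<le> b" "b < ereal c"
  shows "ln_ereal b < ereal (ln c)"
  using assms by (cases b) (auto simp: ln_ereal_def)

lemma power_less_iff_ln_div:
  fixes c p :: real
  assumes "c > 0" "p > 0" "n \<ge> 1"
  shows "c ^ n < p \<longleftrightarrow> ln c < ln p / real n" "p < c ^ n \<longleftrightarrow> ln p / real n < ln c"
proof -
  have "c ^ n < p \<longleftrightarrow> ln (c ^ n) < ln p" "p < c ^ n \<longleftrightarrow> ln p < ln (c ^ n)"
    using assms by (simp_all only: ln_less_cancel_iff zero_less_power)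
  then show "c ^ n < p \<longleftrightarrow> ln c < ln p / real n" "p < c ^ n \<longleftrightarrow> ln p / real n < ln c"
    using assms by (simp_all add: ln_realpow field_simps)
qed

lemma frequently_less_of_less_Limsup:
  fixes f :: "'a \<Rightarrow> ereal"
  assumes "y < Limsup F f"
  shows "\<exists>\<^sub>F x in F. y < f x"
proof (rule ccontr)
  assume "\<not> ?thesis"
  then have "Limsup F f \<le> y" by (intro Limsup_bounded) (simp add: not_frequently not_less)
  with assms show False by simp
qed

lemma frequently_greater_of_Liminf_less:
  fixes f :: "'a \<Rightarrow> ereal"
  assumes "Liminf F f < y"
  shows "\<exists>\<^sub>F x in F. f x < y"
proof (rule ccontr)
  assume "\<not> ?thesis"
  then have "y \<le> Liminf F f" by (intro Liminf_bounded) (simp add: not_frequently not_less)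
  with assms show False by simp
qed

text \<open>For b = 1 no c lies in (1, b), hence the separate treatment of s > 1/2. If s \<le> 1/2,
  then s > 1/(b+1) forces b > 1, and a real c just below b, or a large one if b is infinite, still
  satisfies s > 1/(c+1).\<close>

lemma hausdorff_dim_le:
  fixes b :: ereal
  assumes A: "A \<subseteq> unit_irrationals" and "b \<ge> 1"
    and lin: "\<And>x M. x \<in> A \<Longrightarrow> \<exists>\<^sub>F n in sequentially. M * real n \<le> log_quotient_sum n x"
    and expo: "\<And>x c. x \<in> A \<Longrightarrow> 1 < c \<Longrightarrow> ereal c < b \<Longrightarrow> \<exists>\<^sub>F n in sequentially. c ^ n \<le> log_quotient_sum n x"
  shows "hausdorff_dim A \<le> 1 / (b + 1)"
proof (rule dense_ge)
  fix y :: ereal assume y: "1 / (b + 1) < y"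
  have b0: "0 \<le> 1 / (b + 1)" using \<open>b \<ge> 1\<close> by (cases b) auto
  show "hausdorff_dim A \<le> y"
  proof (cases y)
    case (real s)
    have "s > 0" using b0 y real by (metis ereal_less(2) order_le_less_trans)
    have "hausdorff_measure s A = 0"
    proof (cases "s > 1 / 2")
      case True
      then show ?thesis by (intro hausdorff_measure_eq_0_linear_growth[OF A] lin)
    next
      case False
      have "ereal (max 1 (1 / s - 1)) < b"
      proof (cases b)
        case (real r)
        then have "r \<ge> 1" "1 / (r + 1) < s"
          using \<open>b \<ge> 1\<close> y \<open>y = ereal s\<close> by (auto simp: one_ereal_def)
        moreover from this have "1 < r"
          using False by (cases "r = 1") auto
        ultimately show ?thesis using \<open>s > 0\<close> real by (auto simp: field_simps)
      next
        case PInf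
        have "ereal z < \<infinity>" for z by simp
        then show ?thesis unfolding PInf .
      qed (use \<open>b \<ge> 1\<close> in auto)
      then obtain c where c: "ereal (max 1 (1 / s - 1)) < ereal c" "ereal c < b"
        using ereal_dense2 by blast
      then have "c > 1" "1 / s - 1 < c" by auto
      then have "s > 1 / (c + 1)" using \<open>s > 0\<close> by (simp add: field_simps)
      then show ?thesis
        by (intro hausdorff_measure_eq_0_exponential_growth[OF A \<open>c > 1\<close>] expo c \<open>c > 1\<close>)
    qed
    then show ?thesis
      unfolding hausdorff_dim_def real using \<open>s > 0\<close> by (intro INF_lower) auto
  qed (use y b0 in auto)
qed

text \<open>For infinite b the bound is 0. For finite b a null exponent s < 1/(b+1) leaves room for
  some \<beta> > b with s < 1/(\<beta> + 1), contrary to \<open>H\<close>.\<close>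

lemma hausdorff_dim_ge:
  fixes b :: ereal
  assumes "b \<ge> 1"
    and H: "\<And>\<beta> s. b < ereal \<beta> \<Longrightarrow> 0 \<le> s \<Longrightarrow> s < 1 / (\<beta> + 1) \<Longrightarrow> hausdorff_measure s A \<noteq> 0"
  shows "1 / (b + 1) \<le> hausdorff_dim A"
  unfolding hausdorff_dim_def
proof (rule INF_greatest)
  fix s :: real assume s: "s \<in> {s. 0 \<le> s \<and> hausdorff_measure s A = 0}"
  show "1 / (b + 1) \<le> ereal s"
  proof (rule ccontr)
    assume lt: "\<not> 1 / (b + 1) \<le> ereal s"
    obtain r where r: "b = ereal r" "r \<ge> 1"
      using \<open>b \<ge> 1\<close> lt s by (cases b) (auto simp: one_ereal_def)
    then have sr: "s < 1 / (r + 1)" using lt by (simp add: one_ereal_def)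
    have "\<exists>\<beta>>r. s < 1 / (\<beta> + 1)"
    proof (cases "s = 0")
      case True
      then show ?thesis using r by (intro exI[of _ "r + 1"]) auto
    next
      case False
      then have "s > 0" using s by simp
      then have "r < 1 / s - 1" using sr r by (simp add: field_simps)
      then obtain \<beta> where "r < \<beta>" "\<beta> < 1 / s - 1" using dense by blast
      then show ?thesis using \<open>s > 0\<close> r by (intro exI[of _ \<beta>]) (simp add: field_simps)
    qed
    then show False using H s r by auto
  qed
qed

lemma E_upper_subset: "E_upper \<psi> \<subseteq> unit_irrationals"
  and E_lower_subset: "E_lower \<psi> \<subseteq> unit_irrationals"
  by (auto simp: E_upper_def E_lower_def unit_irrationals_def)

lemma eventually_linear_bound:
  fixes \<psi> :: "nat \<Rightarrow> real"
  assumes "filterlim (\<lambda>n. \<psi> n / real n) at_top sequentially"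
  shows "\<forall>\<^sub>F n in sequentially. M * real n \<le> 1 / 2 * \<psi> n"
proof -
  have "\<forall>\<^sub>F n in sequentially. 2 * M \<le> \<psi> n / real n"
    using assms unfolding filterlim_at_top by blast
  then show ?thesis
    using eventually_ge_at_top[of 1] by eventually_elim (simp add: field_simps)
qed

lemma eventually_power_le_half_power:
  fixes c c1 :: real
  assumes "1 < c" "c < c1"
  shows "\<forall>\<^sub>F n in sequentially. c ^ n \<le> 1 / 2 * c1 ^ n"
proof -
  define q where "q = c1 / c"
  have "q > 1" using assms by (simp add: q_def)
  then have "filterlim (\<lambda>n. q ^ n) at_top sequentially" by real_asymp
  then have "\<forall>\<^sub>F n in sequentially. 2 \<le> q ^ n" unfolding filterlim_at_top by blast
  then show ?thesis
    by eventually_elim (use assms in \<open>simp add: q_def power_divide field_simps\<close>)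
qed

theorem theorem1p2:
  fixes \<psi> :: "nat \<Rightarrow> real" and b B :: ereal
  assumes "\<And>n. n \<ge> 1 \<Longrightarrow> \<psi> n > 0"
    and "filterlim (\<lambda>n. \<psi> n / real n) at_top sequentially"
    and "b \<ge> 1" and "ln_ereal b = liminf (\<lambda>n. ereal (ln (\<psi> n) / real n))"
    and "B \<ge> 1" and "ln_ereal B = limsup (\<lambda>n. ereal (ln (\<psi> n) / real n))"
  shows "hausdorff_dim (E_upper \<psi>) = 1 / (b + 1) \<and> hausdorff_dim (E_lower \<psi>) = 1 / (B + 1)"
proof (intro conjI antisym)
  note pos = assms(1) and lim = assms(2)
  have S_upper: "\<exists>\<^sub>F n in sequentially. 1 / 2 * \<psi> n \<le> log_quotient_sum n x" if "x \<in> E_upper \<psi>" for x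
  \<comment> \<open>Here 1/2 is an arbitrary constant in (0,1); the lost factor is recovered later
    by a slightly smaller base c < c1.\<close>
  proof -
    have "ereal (1 / 2) < limsup (\<lambda>n. ereal (log_quotient_sum n x / \<psi> n))"
      using that by (simp add: E_upper_def one_ereal_def)
    then have "\<exists>\<^sub>F n in sequentially. ereal (1 / 2) < ereal (log_quotient_sum n x / \<psi> n)"
      by (rule frequently_less_of_less_Limsup)
    from frequently_eventually_frequently[OF this eventually_ge_at_top[of 1]] show ?thesis
      by (rule frequently_elim1) (use pos in \<open>auto simp: field_simps\<close>)
  qed
  \<comment> \<open>Here S_n is large eventually, so it may be paired with a lower bound on psi that
    holds only infinitely often, which brings in \<open>B\<close>. For \<open>E_upper\<close> the
    roles are exchanged, which brings in \<open>b\<close>.\<close>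
  have S_lower: "\<forall>\<^sub>F n in sequentially. 1 / 2 * \<psi> n \<le> log_quotient_sum n x" if "x \<in> E_lower \<psi>" for x
  proof -
    have "ereal (1 / 2) < liminf (\<lambda>n. ereal (log_quotient_sum n x / \<psi> n))"
      using that by (simp add: E_lower_def one_ereal_def)
    then have "\<forall>\<^sub>F n in sequentially. ereal (1 / 2) < ereal (log_quotient_sum n x / \<psi> n)"
      by (rule less_LiminfD)
    with eventually_ge_at_top[of 1] show ?thesis
      by eventually_elim (use pos in \<open>auto simp: field_simps\<close>)
  qed

  show "hausdorff_dim (E_upper \<psi>) \<le> 1 / (b + 1)"
  proof (rule hausdorff_dim_le[OF E_upper_subset assms(3)])
    fix x M assume "x \<in> E_upper \<psi>"
    from frequently_eventually_frequently[OF S_upper[OF this] eventually_linear_bound[OF lim, of M]]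
    show "\<exists>\<^sub>F n in sequentially. M * real n \<le> log_quotient_sum n x"
      by (rule frequently_elim1) auto
  next
    fix x c assume x: "x \<in> E_upper \<psi>" and c: "1 < c" "ereal c < b"
    obtain c1 where c1: "ereal c < ereal c1" "ereal c1 < b" using ereal_dense2 c(2) by blast
    have "ereal (ln c1) < liminf (\<lambda>n. ereal (ln (\<psi> n) / real n))"
      using ln_ereal_less[of c1 b] c c1 assms(4) by simp
    then have "\<forall>\<^sub>F n in sequentially. ereal (ln c1) < ereal (ln (\<psi> n) / real n)"
      by (rule less_LiminfD)
    moreover have "\<forall>\<^sub>F n in sequentially. c ^ n \<le> 1 / 2 * c1 ^ n"
      using c c1 by (intro eventually_power_le_half_power) auto
    ultimately have "\<forall>\<^sub>F n in sequentially. c ^ n \<le> 1 / 2 * \<psi> n"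
      using eventually_ge_at_top[of 1]
    proof eventually_elim
      case (elim n)
      then have "c1 ^ n < \<psi> n"
        using power_less_iff_ln_div(1)[of c1 "\<psi> n" n] pos[of n] c c1 by simp
      with elim show ?case by simp
    qed
    from frequently_eventually_frequently[OF S_upper[OF x] this]
    show "\<exists>\<^sub>F n in sequentially. c ^ n \<le> log_quotient_sum n x"
      by (rule frequently_elim1) auto
  qed

  show "hausdorff_dim (E_lower \<psi>) \<le> 1 / (B + 1)"
  proof (rule hausdorff_dim_le[OF E_lower_subset assms(5)])
    fix x M assume "x \<in> E_lower \<psi>"
    from S_lower[OF this] eventually_linear_bound[OF lim, of M]
    have "\<forall>\<^sub>F n in sequentially. M * real n \<le> log_quotient_sum n x"
      by eventually_elim simp
    then show "\<exists>\<^sub>F n in sequentially. M * real n \<le> log_quotient_sum n x"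
      by (rule eventually_frequently[rotated]) simp
  next
    fix x c assume x: "x \<in> E_lower \<psi>" and c: "1 < c" "ereal c < B"
    obtain c1 where c1: "ereal c < ereal c1" "ereal c1 < B" using ereal_dense2 c(2) by blast
    have "ereal (ln c1) < limsup (\<lambda>n. ereal (ln (\<psi> n) / real n))"
      using ln_ereal_less[of c1 B] c c1 assms(6) by simp
    then have *: "\<exists>\<^sub>F n in sequentially. ereal (ln c1) < ereal (ln (\<psi> n) / real n)"
      by (rule frequently_less_of_less_Limsup)
    have "\<forall>\<^sub>F n in sequentially. c ^ n \<le> 1 / 2 * c1 ^ n"
      using c c1 by (intro eventually_power_le_half_power) auto
    with S_lower[OF x] eventually_ge_at_top[of 1]
    have "\<forall>\<^sub>F n in sequentially. ereal (ln c1) < ereal (ln (\<psi> n) / real n) \<longrightarrow> c ^ n \<le> log_quotient_sum n x"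
    proof eventually_elim
      case (elim n)
      then show ?case
        using power_less_iff_ln_div(1)[of c1 "\<psi> n" n] pos[of n] c c1 by auto
    qed
    from frequently_eventually_frequently[OF * this]
    show "\<exists>\<^sub>F n in sequentially. c ^ n \<le> log_quotient_sum n x"
      by (rule frequently_elim1) auto
  qed

  show "1 / (b + 1) \<le> hausdorff_dim (E_upper \<psi>)"
  proof (rule hausdorff_dim_ge[OF assms(3)])
    fix \<beta> s :: real assume \<beta>: "b < ereal \<beta>" and s: "0 \<le> s" "s < 1 / (\<beta> + 1)"
    have "1 < \<beta>" using assms(3) \<beta> by (cases b) (auto simp: one_ereal_def)
    \<comment> \<open>psi n < c^n holds infinitely often, and the gap between c and \<beta> supplies
      the arbitrarily small factor \<epsilon>.\<close>
    obtain c where c: "b < ereal c" "ereal c < ereal \<beta>" using ereal_dense2 \<beta> by blast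
    then have "1 < c" using assms(3) by (cases b) (auto simp: one_ereal_def)
    have "liminf (\<lambda>n. ereal (ln (\<psi> n) / real n)) < ereal (ln c)"
      using ln_ereal_greater[of b c] c assms(3,4) by simp
    then have freq: "\<exists>\<^sub>F n in sequentially. ereal (ln (\<psi> n) / real n) < ereal (ln c)"
      by (rule frequently_greater_of_Liminf_less)
    have small: "\<exists>n\<ge>1. \<psi> n < \<epsilon> * \<beta> ^ n" if "\<epsilon> > 0" for \<epsilon>
    proof -
      define q where "q = \<beta> / c"
      have "q > 1" using c \<open>1 < c\<close> by (simp add: q_def)
      then have "filterlim (\<lambda>n. q ^ n) at_top sequentially" by real_asymp
      then have "\<forall>\<^sub>F n in sequentially. 1 / \<epsilon> \<le> q ^ n" unfolding filterlim_at_top by blast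
      then have "\<forall>\<^sub>F n in sequentially. n \<ge> 1 \<and> c ^ n \<le> \<epsilon> * \<beta> ^ n"
        using eventually_ge_at_top[of 1]
        by eventually_elim (use that \<open>1 < c\<close> in \<open>simp add: q_def power_divide field_simps\<close>)
      from frequently_ex[OF frequently_eventually_frequently[OF freq this]]
      obtain n where n: "ln (\<psi> n) / real n < ln c" "n \<ge> 1" "c ^ n \<le> \<epsilon> * \<beta> ^ n" by auto
      then have "\<psi> n < c ^ n"
        using power_less_iff_ln_div(2)[of c "\<psi> n" n] pos[of n] \<open>1 < c\<close> by simp
      with n show ?thesis by (intro exI[of _ n]) auto
    qed
    obtain \<theta> where \<theta>: "regular_growth \<beta> \<theta>" "\<forall>n\<ge>1. \<theta> n \<le> \<psi> n" "\<exists>\<^sub>F n in sequentially. \<theta> n = \<psi> n"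
      by (rule regular_minorant[of \<psi> \<beta>, OF pos lim \<open>1 < \<beta>\<close> small])
    let ?A = "{x \<in> unit_irrationals. (\<lambda>n. log_quotient_sum n x / \<theta> n) \<longlonglongrightarrow> 1}"
    have "?A \<subseteq> E_upper \<psi>"
    proof safe
      fix x assume x: "x \<in> unit_irrationals" "(\<lambda>n. log_quotient_sum n x / \<theta> n) \<longlonglongrightarrow> 1"
      have tend: "(\<lambda>n. ereal (log_quotient_sum n x / \<theta> n)) \<longlonglongrightarrow> 1"
        using x(2) by (simp add: one_ereal_def)
      have "limsup (\<lambda>n. ereal (log_quotient_sum n x / \<psi> n)) \<le> limsup (\<lambda>n. ereal (log_quotient_sum n x / \<theta> n))"
      proof (rule Limsup_mono)
        show "\<forall>\<^sub>F n in sequentially. ereal (log_quotient_sum n x / \<psi> n) \<le> ereal (log_quotient_sum n x / \<theta> n)"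
          using eventually_ge_at_top[of 1]
        proof eventually_elim
          case (elim n)
          then show ?case using \<theta>(1,2) pos[of n] log_quotient_sum_nonneg[OF x(1), of n]
            by (auto simp: regular_growth_def intro!: divide_left_mono)
        qed
      qed
      also have "\<dots> = 1" using tend by (intro lim_imp_Limsup) auto
      finally have le: "limsup (\<lambda>n. ereal (log_quotient_sum n x / \<psi> n)) \<le> 1" .
      \<comment> \<open>A y strictly between the limsup and 1 would eventually separate the
        quotients by psi and by theta, leaving only finitely many contacts. The lower limit is
        treated symmetrically.\<close>
      have "\<not> limsup (\<lambda>n. ereal (log_quotient_sum n x / \<psi> n)) < 1"
      proof
        assume "limsup (\<lambda>n. ereal (log_quotient_sum n x / \<psi> n)) < 1"
        then obtain y where y: "limsup (\<lambda>n. ereal (log_quotient_sum n x / \<psi> n)) < y" "y < 1"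
          using dense by blast
        have "\<forall>\<^sub>F n in sequentially. ereal (log_quotient_sum n x / \<psi> n) < y"
          using y(1) by (rule Limsup_lessD)
        moreover have "\<forall>\<^sub>F n in sequentially. y < ereal (log_quotient_sum n x / \<theta> n)"
          using tend y(2) by (rule order_tendstoD)
        ultimately have "\<forall>\<^sub>F n in sequentially. \<theta> n \<noteq> \<psi> n"
          by eventually_elim auto
        with \<theta>(3) show False by (simp add: frequently_def)
      qed
      with le x(1) show "x \<in> E_upper \<psi>" by (auto simp: E_upper_def unit_irrationals_def)
    qed
    moreover have "hausdorff_measure s ?A \<noteq> 0"
      using \<open>1 < \<beta>\<close> by (intro hausdorff_measure_neq_0_regular[OF \<theta>(1)] s) auto
    ultimately show "hausdorff_measure s (E_upper \<psi>) \<noteq> 0"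
      using hausdorff_measure_mono[of ?A "E_upper \<psi>" s] by auto
  qed

  show "1 / (B + 1) \<le> hausdorff_dim (E_lower \<psi>)"
  proof (rule hausdorff_dim_ge[OF assms(5)])
    fix \<beta> s :: real assume \<beta>: "B < ereal \<beta>" and s: "0 \<le> s" "s < 1 / (\<beta> + 1)"
    have "1 < \<beta>" using assms(5) \<beta> by (cases B) (auto simp: one_ereal_def)
    obtain c where c: "B < ereal c" "ereal c < ereal \<beta>" using ereal_dense2 \<beta> by blast
    then have "1 < c" using assms(5) by (cases B) (auto simp: one_ereal_def)
    have "limsup (\<lambda>n. ereal (ln (\<psi> n) / real n)) < ereal (ln c)"
      using ln_ereal_greater[of B c] c assms(5,6) by simp
    then have ev: "\<forall>\<^sub>F n in sequentially. ereal (ln (\<psi> n) / real n) < ereal (ln c)"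
      by (rule Limsup_lessD)
    \<comment> \<open>Now psi n < c^n holds eventually, so \<beta>^n / psi n tends to infinity; this
      is why the maximum defining the majorant is attained.\<close>
    have large: "filterlim (\<lambda>n. \<beta> ^ n / \<psi> n) at_top sequentially"
    proof (rule filterlim_at_top_mono)
      define q where "q = \<beta> / c"
      have "q > 1" using c \<open>1 < c\<close> by (simp add: q_def)
      then show "filterlim (\<lambda>n. q ^ n) at_top sequentially" by real_asymp
      show "\<forall>\<^sub>F n in sequentially. q ^ n \<le> \<beta> ^ n / \<psi> n"
        using ev eventually_ge_at_top[of 1]
      proof eventually_elim
        case (elim n)
        then have "\<psi> n < c ^ n"
          using power_less_iff_ln_div(2)[of c "\<psi> n" n] pos[of n] \<open>1 < c\<close> by simp
        then show ?case
          unfolding q_def power_divide using pos[of n] elim \<open>1 < c\<close> \<open>1 < \<beta>\<close>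
          by (intro divide_left_mono) auto
      qed
    qed
    obtain \<theta> where \<theta>: "regular_growth \<beta> \<theta>" "\<forall>n\<ge>1. \<psi> n \<le> \<theta> n" "\<exists>\<^sub>F n in sequentially. \<theta> n = \<psi> n"
      by (rule regular_majorant[of \<psi> \<beta>, OF pos lim \<open>1 < \<beta>\<close> large])
    let ?A = "{x \<in> unit_irrationals. (\<lambda>n. log_quotient_sum n x / \<theta> n) \<longlonglongrightarrow> 1}"
    have "?A \<subseteq> E_lower \<psi>"
    proof safe
      fix x assume x: "x \<in> unit_irrationals" "(\<lambda>n. log_quotient_sum n x / \<theta> n) \<longlonglongrightarrow> 1"
      have tend: "(\<lambda>n. ereal (log_quotient_sum n x / \<theta> n)) \<longlonglongrightarrow> 1"
        using x(2) by (simp add: one_ereal_def)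
      have "1 = liminf (\<lambda>n. ereal (log_quotient_sum n x / \<theta> n))"
        using tend by (intro lim_imp_Liminf[symmetric]) auto
      also have "\<dots> \<le> liminf (\<lambda>n. ereal (log_quotient_sum n x / \<psi> n))"
      proof (rule Liminf_mono)
        show "\<forall>\<^sub>F n in sequentially. ereal (log_quotient_sum n x / \<theta> n) \<le> ereal (log_quotient_sum n x / \<psi> n)"
          using eventually_ge_at_top[of 1]
        proof eventually_elim
          case (elim n)
          then show ?case using \<theta>(1,2) pos[of n] log_quotient_sum_nonneg[OF x(1), of n]
            by (auto simp: regular_growth_def intro!: divide_left_mono)
        qed
      qed
      finally have le: "1 \<le> liminf (\<lambda>n. ereal (log_quotient_sum n x / \<psi> n))" .
      have "\<not> 1 < liminf (\<lambda>n. ereal (log_quotient_sum n x / \<psi> n))"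
      proof
        assume "1 < liminf (\<lambda>n. ereal (log_quotient_sum n x / \<psi> n))"
        then obtain y where y: "y < liminf (\<lambda>n. ereal (log_quotient_sum n x / \<psi> n))" "1 < y"
          using dense by blast
        have "\<forall>\<^sub>F n in sequentially. y < ereal (log_quotient_sum n x / \<psi> n)"
          using y(1) by (rule less_LiminfD)
        moreover have "\<forall>\<^sub>F n in sequentially. ereal (log_quotient_sum n x / \<theta> n) < y"
          using tend y(2) by (rule order_tendstoD)
        ultimately have "\<forall>\<^sub>F n in sequentially. \<theta> n \<noteq> \<psi> n"
          by eventually_elim auto
        with \<theta>(3) show False by (simp add: frequently_def)
      qed
      with le x(1) show "x \<in> E_lower \<psi>" by (auto simp: E_lower_def unit_irrationals_def)
    qed
    moreover have "hausdorff_measure s ?A \<noteq> 0"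
      using \<open>1 < \<beta>\<close> by (intro hausdorff_measure_neq_0_regular[OF \<theta>(1)] s) auto
    ultimately show "hausdorff_measure s (E_lower \<psi>) \<noteq> 0"
      using hausdorff_measure_mono[of ?A "E_lower \<psi>" s] by auto
  qed
qed

end
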